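(* Let $F:\mathbb R^3\to\mathbb R$, $(x,y,z)\mapsto F(x,y,z)$, be a continuous function such that, for every compact interval $K\subset\mathbb R$, the restriction of $F$ to $K\times\mathbb R^2$ is Lipschitz with respect to $(y,z)$, uniformly in $x\in K$. Then for all $x_0,x_1\in\mathbb R$ there is a unique $C^1$-solution $u:\mathbb R\to\mathbb R$ of $$Lu=F(x,u(x),u'(x)),\ x\in\mathbb R,\qquad u(0)=x_0,\qquad u'(0)=x_1 .$$
   Context: Let $\sigma,\beta:\mathbb R\to\mathbb R$ be continuous with $\sigma>0$. $C^0$ denotes the continuous functions on $\mathbb R$ with the topology of uniform convergence on compacts; $C^k$ the $k$-times continuously differentiable functions on $\mathbb R$ with the topology of uniform convergence on compacts of the function and its first $k$ derivatives. Formally $Lg=\frac{\sigma^2}{2}g''+\beta'g'$. A mollifier is a Schwartz function $\Phi$ on $\mathbb R$ with $\int\Phi(x)\,dx=1$; put $\Phi_n(x)=n\Phi(nx)$, $\sigma_n^2=\sigma^2*\Phi_n$, $\beta_n=\beta*\Phi_n$ (these convolutions are understood to be well defined, as absolutely convergent integrals, for every mollifier) and $L_ng=\frac{\sigma_n^2}{2}g''+\beta_n'g'$. Standing assumption: $\Sigma(x)=\lim_{n\to\infty}2\int_0^x\frac{\beta_n'}{\sigma_n^2}(y)\,dy$ exists in $C^0$, independently of the mollifier. For $l\in C^0$, a function $f\in C^1$ is a $C^1$-solution of $Lf=l$ if for every mollifier $\Phi$ there are sequences $(f_n)$ in $C^2$ and $(l_n)$ in $C^0$ with $L_nf_n=l_n$,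 $f_n\to f$ in $C^1$, $l_n\to l$ in $C^0$. For continuous $F:\mathbb R^3\to\mathbb R$, $u\in C^1$ is a $C^1$-solution of $Lu=F(x,u,u')$ if $u$ is a $C^1$-solution of $Lu=h$ with $h(x)=F(x,u(x),u'(x))$. *)

theory Defs
  imports "HOL-Analysis.Analysis"
begin

definition C_k :: "nat \<Rightarrow> (real \<Rightarrow> real) \<Rightarrow> bool" where
  "C_k k f \<longleftrightarrow>
     (\<forall>j<k. \<forall>x. (deriv ^^ j) f differentiable (at x)) \<and> continuous_on UNIV ((deriv ^^ k) f)"

text \<open>Sequential convergence in the topology of uniform convergence on compacts of the
  derivatives of orders \<open>0, \<dots>, k\<close>.\<close>

definition C_k_tendsto :: "nat \<Rightarrow> (nat \<Rightarrow> real \<Rightarrow> real) \<Rightarrow> (real \<Rightarrow> real) \<Rightarrow> bool" where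
  "C_k_tendsto k fs f \<longleftrightarrow>
     (\<forall>j\<le>k. \<forall>K. compact K \<longrightarrow>
        uniform_limit K (\<lambda>n. (deriv ^^ j) (fs n)) ((deriv ^^ j) f) sequentially)"

definition schwartz :: "(real \<Rightarrow> real) \<Rightarrow> bool" where
  "schwartz \<Phi> \<longleftrightarrow>
     (\<forall>k. C_k k \<Phi>) \<and> (\<forall>m k. bounded (range (\<lambda>x. x ^ m * (deriv ^^ k) \<Phi> x)))"

definition mollifier :: "(real \<Rightarrow> real) \<Rightarrow> bool" where
  "mollifier \<Phi> \<longleftrightarrow> schwartz \<Phi> \<and> (LBINT x. \<Phi> x) = 1"

definition rescale :: "(real \<Rightarrow> real) \<Rightarrow> nat \<Rightarrow> real \<Rightarrow> real" where
  "rescale \<Phi> n x = real n * \<Phi> (real n * x)"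

definition convolvable :: "(real \<Rightarrow> real) \<Rightarrow> (real \<Rightarrow> real) \<Rightarrow> bool" where
  "convolvable f g \<longleftrightarrow> (\<forall>x. integrable lborel (\<lambda>y. f (x - y) * g y))"

definition convolution :: "(real \<Rightarrow> real) \<Rightarrow> (real \<Rightarrow> real) \<Rightarrow> real \<Rightarrow> real" where
  "convolution f g x = (LBINT y. f (x - y) * g y)"

definition sigma2_n :: "(real \<Rightarrow> real) \<Rightarrow> (real \<Rightarrow> real) \<Rightarrow> nat \<Rightarrow> real \<Rightarrow> real" where
  "sigma2_n \<sigma> \<Phi> n = convolution (\<lambda>x. (\<sigma> x)\<^sup>2) (rescale \<Phi> n)"

definition beta_n :: "(real \<Rightarrow> real) \<Rightarrow> (real \<Rightarrow> real) \<Rightarrow> nat \<Rightarrow> real \<Rightarrow> real" where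
  "beta_n \<beta> \<Phi> n = convolution \<beta> (rescale \<Phi> n)"

definition L_n ::
  "(real \<Rightarrow> real) \<Rightarrow> (real \<Rightarrow> real) \<Rightarrow> (real \<Rightarrow> real) \<Rightarrow> nat \<Rightarrow> (real \<Rightarrow> real) \<Rightarrow> real \<Rightarrow> real" where
  "L_n \<sigma> \<beta> \<Phi> n g x =
     sigma2_n \<sigma> \<Phi> n x / 2 * deriv (deriv g) x + deriv (beta_n \<beta> \<Phi> n) x * deriv g x"

text \<open>A mollifier may change sign, so \<open>sigma2_n \<sigma> \<Phi> n\<close> may have zeros for small \<open>n\<close>.  It converges
  to \<open>\<sigma>\<^sup>2 > 0\<close> uniformly on compacts, so on each compact set the integrand below is continuous
  for all large \<open>n\<close>, and the locally uniform limit is insensitive to the value at the others.\<close>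

definition Sigma_n ::
  "(real \<Rightarrow> real) \<Rightarrow> (real \<Rightarrow> real) \<Rightarrow> (real \<Rightarrow> real) \<Rightarrow> nat \<Rightarrow> real \<Rightarrow> real" where
  "Sigma_n \<sigma> \<beta> \<Phi> n x =
     2 * (LBINT y=0..ereal x. deriv (beta_n \<beta> \<Phi> n) y / sigma2_n \<sigma> \<Phi> n y)"

text \<open>The index \<open>n = 0\<close> is excluded, since \<open>rescale \<Phi> 0\<close> is not a mollifier.  The right-hand side
  \<open>l\<close> is meant to be continuous.\<close>

definition C1_solution ::
  "(real \<Rightarrow> real) \<Rightarrow> (real \<Rightarrow> real) \<Rightarrow> (real \<Rightarrow> real) \<Rightarrow> (real \<Rightarrow> real) \<Rightarrow> bool" where
  "C1_solution \<sigma> \<beta> l f \<longleftrightarrow>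
     C_k 1 f \<and>
     (\<forall>\<Phi>. mollifier \<Phi> \<longrightarrow>
       (\<exists>fs ls.
          (\<forall>n\<ge>1. C_k 2 (fs n) \<and> C_k 0 (ls n) \<and> (\<forall>x. L_n \<sigma> \<beta> \<Phi> n (fs n) x = ls n x)) \<and>
          C_k_tendsto 1 fs f \<and> C_k_tendsto 0 ls l))"

definition C1_solution_semilinear ::
  "(real \<Rightarrow> real) \<Rightarrow> (real \<Rightarrow> real) \<Rightarrow> (real \<times> real \<times> real \<Rightarrow> real) \<Rightarrow> (real \<Rightarrow> real) \<Rightarrow> bool" where
  "C1_solution_semilinear \<sigma> \<beta> F u \<longleftrightarrow>
     C_k 1 u \<and> C1_solution \<sigma> \<beta> (\<lambda>x. F (x, u x, deriv u x)) u"

end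

theory Submission
  imports Defs
begin

text \<open>
  Since every mollifier may be used, convolvability forces \<open>\<sigma>\<^sup>2\<close> and \<open>\<beta>\<close> to grow moderately in the mean:
  \<open>\<bar>f t\<bar> / (1 + \<bar>t\<bar>) ^ p\<close> is integrable for some \<open>p\<close>. Hence the mollified coefficients are
  \<open>C\<^sup>1\<close> and \<open>\<sigma>\<^sub>n\<^sup>2 \<longlongrightarrow> \<sigma>\<^sup>2\<close> locally uniformly. With the integrating factor
  \<open>exp \<Sigma>\<^sub>n\<close> the equation \<open>L\<^sub>n f\<^sub>n = l\<^sub>n\<close> becomes
  \<open>(exp \<Sigma>\<^sub>n f\<^sub>n')' = 2 exp \<Sigma>\<^sub>n l\<^sub>n / \<sigma>\<^sub>n\<^sup>2\<close>, and in the limit \<open>f\<close> is a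
  \<open>C\<^sup>1\<close>-solution of \<open>L f = l\<close> iff \<open>(exp \<Sigma> f')' = 2 exp \<Sigma> l / \<sigma>\<^sup>2\<close>. So the
  semilinear equation is a first order system for \<open>(u, exp \<Sigma> u')\<close> that is continuous in \<open>x\<close> and
  Lipschitz in the unknowns, and Picard iteration solves it globally and uniquely.
\<close>

section \<open>Schwartz functions and Gaussian series\<close>

text \<open>The derivative of \<beta> need not exist as a function, so L itself cannot be analysed;
  only the primitive \<Sigma> of 2 \<beta>'/\<sigma>^2 survives the limit. Accordingly the second
  unknown of the system is exp \<Sigma> u', which is differentiable even where u' is not.
  Convolvability concerns each mollifier separately and carries no rate. The rate comes from a
  gliding hump: if no polynomial bound held, Gaussian bumps placed at the worst spots would add up
  to one mollifier whose convolution diverges. Gaussians keep every term explicit and positive, so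
  that nothing cancels. Mollifiers may change sign, so L_n can degenerate outside compact sets that
  grow with n. The definition of a solution leaves l_n free, and this freedom absorbs the defect:
  the approximants solve a regularized equation, and l_n is whatever L_n makes of them. On each
  compact set it equals l for large n.\<close>

lemma deriv_iterates:
  fixes h :: "nat \<Rightarrow> real \<Rightarrow> real"
  assumes "\<And>k x. (h k has_real_derivative h (Suc k) x) (at x)"
  shows "(deriv ^^ k) (h 0) = h k"
proof (induction k)
  case (Suc k)
  have "deriv (h k) = h (Suc k)"
    using DERIV_imp_deriv[OF assms] by blast
  with Suc show ?case by simp
qed simp

text \<open>The derivatives are supplied as a candidate sequence \<open>h\<close>, so that concrete
  functions can be treated by explicit formulas instead of iterated \<open>deriv\<close>.\<close>

lemma schwartzI:
  fixes h :: "nat \<Rightarrow> real \<Rightarrow> real"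
  assumes h: "\<And>k x. (h k has_real_derivative h (Suc k) x) (at x)"
    and b: "\<And>m k. bounded (range (\<lambda>x. x ^ m * h k x))"
  shows "schwartz (h 0)"
proof -
  have "(deriv ^^ k) (h 0) = h k" for k
    by (rule deriv_iterates) (rule h)
  moreover have "h k differentiable (at x)" for k x
    using h unfolding real_differentiable_def by blast
  moreover have "continuous_on UNIV (h k)" for k
    using h DERIV_isCont continuous_at_imp_continuous_on by blast
  ultimately show ?thesis
    unfolding schwartz_def C_k_def using b by auto
qed

lemma schwartz_deriv:
  assumes "schwartz \<Phi>"
  shows "((deriv ^^ k) \<Phi> has_real_derivative (deriv ^^ Suc k) \<Phi> x) (at x)"
proof -
  have "(deriv ^^ k) \<Phi> differentiable (at x)"
    using assms unfolding schwartz_def C_k_def by blast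
  then show ?thesis
    using DERIV_deriv_iff_real_differentiable by simp
qed

lemma schwartz_continuous:
  assumes "schwartz \<Phi>"
  shows "continuous_on S ((deriv ^^ k) \<Phi>)"
  using schwartz_deriv[OF assms] DERIV_isCont continuous_at_imp_continuous_on by blast

lemma schwartz_scale:
  assumes "schwartz \<Phi>" and b: "b \<noteq> 0"
  shows "schwartz (\<lambda>x. a * \<Phi> (b * x))"
proof -
  define h where "h k x = a * b ^ k * (deriv ^^ k) \<Phi> (b * x)" for k x
  have "schwartz (h 0)"
  proof (rule schwartzI)
    show "(h k has_real_derivative h (Suc k) x) (at x)" for k x
      unfolding h_def
      by (rule derivative_eq_intros DERIV_chain2[OF schwartz_deriv[OF assms(1)]] refl | simp)+
    show "bounded (range (\<lambda>x. x ^ m * h k x))" for m k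
    proof -
      obtain B where B: "\<And>x. \<bar>x ^ m * (deriv ^^ k) \<Phi> x\<bar> \<le> B"
        using assms unfolding schwartz_def bounded_iff by fastforce
      have "\<bar>x ^ m * h k x\<bar> \<le> \<bar>a * b ^ k\<bar> / \<bar>b\<bar> ^ m * B" for x
      proof -
        have "\<bar>x ^ m * h k x\<bar> = \<bar>a * b ^ k\<bar> / \<bar>b\<bar> ^ m * \<bar>(b * x) ^ m * (deriv ^^ k) \<Phi> (b * x)\<bar>"
          using b by (simp add: h_def abs_mult power_abs power_mult_distrib)
        then show ?thesis using B[of "b * x"] by (metis abs_ge_zero divide_nonneg_nonneg mult_left_mono zero_le_power)
      qed
      then show ?thesis unfolding bounded_iff by auto
    qed
  qed
  then show ?thesis by (simp add: h_def[abs_def])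
qed


lemma abs_add_power_le:
  fixes x y :: real
  shows "\<bar>x + y\<bar> ^ m \<le> 2 ^ m * (\<bar>x\<bar> ^ m + \<bar>y\<bar> ^ m)"
proof -
  have "\<bar>x + y\<bar> \<le> 2 * max \<bar>x\<bar> \<bar>y\<bar>"
    by (cases "\<bar>x\<bar> \<le> \<bar>y\<bar>") (simp_all add: max_def)
  then have "\<bar>x + y\<bar> ^ m \<le> (2 * max \<bar>x\<bar> \<bar>y\<bar>) ^ m"
    by (rule power_mono) simp
  also have "\<dots> \<le> 2 ^ m * (\<bar>x\<bar> ^ m + \<bar>y\<bar> ^ m)"
    unfolding power_mult_distrib by (auto simp: max_def)
  finally show ?thesis .
qed

text \<open>The seminorms for the powers 0 and p suffice, because (1 + \<bar>x\<bar>)^p is at most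
  2^p (1 + \<bar>x\<bar>^p). Unlike a monomial, this weight has no zero and can be divided
  by.\<close>

lemma schwartz_decay:
  assumes "schwartz \<Phi>"
  obtains C where "C > 0" "\<And>x. \<bar>(deriv ^^ k) \<Phi> x\<bar> \<le> C / (1 + \<bar>x\<bar>) ^ p"
proof -
  have "\<exists>B. \<forall>x. \<bar>x ^ m * (deriv ^^ k) \<Phi> x\<bar> \<le> B" for m
    using assms unfolding schwartz_def bounded_iff by fastforce
  then obtain B where B: "\<And>m x. \<bar>x ^ m * (deriv ^^ k) \<Phi> x\<bar> \<le> B m"
    by metis
  have Bn: "0 \<le> B m" for m
    using B[of 0 m] abs_ge_zero order_trans by blast
  \<comment> \<open>The summand 1 only serves to make \<open>C\<close> strictly positive.\<close>
  define C where "C = 2 ^ p * (B 0 + B p) + 1"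
  have "\<bar>(deriv ^^ k) \<Phi> x\<bar> \<le> C / (1 + \<bar>x\<bar>) ^ p" for x
  proof -
    have "(1 + \<bar>x\<bar>) ^ p \<le> 2 ^ p * (1 + \<bar>x\<bar> ^ p)"
      using abs_add_power_le[of 1 "\<bar>x\<bar>" p] by simp
    then have "(1 + \<bar>x\<bar>) ^ p * \<bar>(deriv ^^ k) \<Phi> x\<bar>
        \<le> 2 ^ p * (1 + \<bar>x\<bar> ^ p) * \<bar>(deriv ^^ k) \<Phi> x\<bar>"
      by (rule mult_right_mono) simp
    also have "\<dots> = 2 ^ p * (\<bar>x ^ 0 * (deriv ^^ k) \<Phi> x\<bar> + \<bar>x ^ p * (deriv ^^ k) \<Phi> x\<bar>)"
      by (simp add: abs_mult power_abs algebra_simps)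
    also have "\<dots> \<le> 2 ^ p * (B 0 + B p)"
      by (intro mult_left_mono add_mono B) auto
    finally show ?thesis
      unfolding C_def by (subst pos_le_divide_eq) (auto simp: mult.commute intro: order_trans)
  qed
  moreover have "C > 0"
    unfolding C_def using Bn by (intro add_nonneg_pos mult_nonneg_nonneg add_nonneg_nonneg) auto
  ultimately show ?thesis by (rule that[rotated])
qed

section \<open>The Gaussian, its derivatives and series of its translates\<close>

definition gauss :: "real \<Rightarrow> real" where
  "gauss x = exp (- x\<^sup>2)"

text \<open>Up to the sign (-1)^k these are the physicists' Hermite polynomials.\<close>

fun gauss_poly :: "nat \<Rightarrow> real poly" where
  "gauss_poly 0 = 1"
| "gauss_poly (Suc k) = pderiv (gauss_poly k) - [:0, 2:] * gauss_poly k"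

definition gauss_deriv :: "nat \<Rightarrow> real \<Rightarrow> real" where
  "gauss_deriv k x = poly (gauss_poly k) x * gauss x"

lemma gauss_deriv_0 [simp]: "gauss_deriv 0 = gauss"
  by (simp add: gauss_deriv_def fun_eq_iff)

lemma gauss_deriv_Suc:
  "(gauss_deriv k has_real_derivative gauss_deriv (Suc k) x) (at x)"
  unfolding gauss_deriv_def[abs_def] gauss_def[abs_def]
  by (auto intro!: derivative_eq_intros simp: algebra_simps)

lemma power_le_fact_exp:
  fixes x :: real
  assumes "x \<ge> 0"
  shows "x ^ m \<le> fact m * exp x"
proof -
  have "x ^ m /\<^sub>R fact m = (\<Sum>n\<in>{m}. x ^ n /\<^sub>R fact n)" by simp
  also have "\<dots> \<le> exp x"
    unfolding exp_def using assms summable_exp_generic[of x] by (intro sum_le_suminf) auto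
  finally show ?thesis
    by (simp add: field_simps)
qed

text \<open>Induction on the coefficients with \<open>m\<close> arbitrary: in a + x p(x) the extra
  factor x is absorbed by raising \<open>m\<close> by one. The constant a is handled by
  \<bar>x\<bar>^m \<le> m! exp \<bar>x\<bar>, which the Gaussian beats since \<bar>x\<bar> - x^2 is
  bounded.\<close>

lemma gauss_times_poly_bounded:
  "\<exists>B. \<forall>x. \<bar>x\<bar> ^ m * \<bar>poly p x\<bar> * gauss x \<le> B"
proof (induction p arbitrary: m)
  case 0
  show ?case by auto
next
  case (pCons a p)
  obtain B where B: "\<And>x. \<bar>x\<bar> ^ Suc m * \<bar>poly p x\<bar> * gauss x \<le> B"
    using pCons.IH by blast
  have "\<bar>x\<bar> ^ m * \<bar>poly (pCons a p) x\<bar> * gauss x \<le> \<bar>a\<bar> * (fact m * exp 1) + B" for x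
  proof -
    have "\<bar>x\<bar> - x\<^sup>2 \<le> 1"
      using zero_le_power2[of "\<bar>x\<bar> - 1 / 2"] by (simp add: power2_eq_square algebra_simps)
    have "\<bar>x\<bar> ^ m * gauss x \<le> fact m * exp \<bar>x\<bar> * gauss x"
      by (intro mult_right_mono power_le_fact_exp) (auto simp: gauss_def)
    also have "\<dots> = fact m * exp (\<bar>x\<bar> - x\<^sup>2)"
      by (simp add: gauss_def exp_add[symmetric])
    also have "\<dots> \<le> fact m * exp 1"
      using \<open>\<bar>x\<bar> - x\<^sup>2 \<le> 1\<close> by simp
    finally have 1: "\<bar>x\<bar> ^ m * gauss x \<le> fact m * exp 1" .
    have "\<bar>x\<bar> ^ m * \<bar>poly (pCons a p) x\<bar> * gauss x
        \<le> \<bar>x\<bar> ^ m * (\<bar>a\<bar> + \<bar>x * poly p x\<bar>) * gauss x"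
      by (intro mult_right_mono mult_left_mono) (auto simp: gauss_def)
    also have "\<dots> = \<bar>a\<bar> * (\<bar>x\<bar> ^ m * gauss x) + \<bar>x\<bar> ^ Suc m * \<bar>poly p x\<bar> * gauss x"
      by (simp add: abs_mult algebra_simps)
    also have "\<dots> \<le> \<bar>a\<bar> * (fact m * exp 1) + B"
      by (intro add_mono mult_left_mono 1 B) auto
    finally show ?thesis .
  qed
  then show ?case by blast
qed

lemma gauss_deriv_bounded:
  obtains B where "B \<ge> 0" "\<And>x. \<bar>x\<bar> ^ m * \<bar>gauss_deriv k x\<bar> \<le> B"
proof -
  obtain B where B: "\<And>x. \<bar>x\<bar> ^ m * \<bar>poly (gauss_poly k) x\<bar> * gauss x \<le> B"
    using gauss_times_poly_bounded by blast
  have "\<bar>x\<bar> ^ m * \<bar>gauss_deriv k x\<bar> \<le> max B 0" for x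
    using B[of x] by (auto simp: gauss_deriv_def abs_mult gauss_def mult.assoc intro: order_trans)
  then show ?thesis by (intro that[of "max B 0"]) auto
qed

text \<open>Splitting \<bar>x\<bar>^m into \<bar>x - s\<bar>^m and \<bar>s\<bar>^m leaves one factor
  for the Gaussian to control and one for the moments of \<open>c\<close>. This gives a summable
  majorant independent of x for every derivative, hence termwise differentiation and all Schwartz
  seminorms.\<close>

lemma schwartz_gauss_series:
  fixes c s :: "nat \<Rightarrow> real"
  assumes c: "\<And>j. c j \<ge> 0" and summ: "\<And>m. summable (\<lambda>j. c j * \<bar>s j\<bar> ^ m)"
  shows "summable (\<lambda>j. c j * gauss (x - s j))"
    and "schwartz (\<lambda>x. \<Sum>j. c j * gauss (x - s j))"
proof -
  define t where "t k j x = c j * gauss_deriv k (x - s j)" for k j x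
  define h where "h k x = (\<Sum>j. t k j x)" for k x
  have tb: "\<exists>M. summable M \<and> (\<forall>j x. \<bar>x ^ m * t k j x\<bar> \<le> M j)" for m k
  proof -
    obtain A where A: "A \<ge> 0" "\<And>x. \<bar>x\<bar> ^ m * \<bar>gauss_deriv k x\<bar> \<le> A"
      using gauss_deriv_bounded[of m k] by blast
    obtain B where B: "B \<ge> 0" "\<And>x. \<bar>x\<bar> ^ 0 * \<bar>gauss_deriv k x\<bar> \<le> B"
      using gauss_deriv_bounded[of 0 k] by blast
    let ?M = "\<lambda>j. 2 ^ m * A * (c j * \<bar>s j\<bar> ^ 0) + 2 ^ m * B * (c j * \<bar>s j\<bar> ^ m)"
    have "\<bar>x ^ m * t k j x\<bar> \<le> ?M j" for j x
    proof -
      have "\<bar>x\<bar> ^ m \<le> 2 ^ m * (\<bar>x - s j\<bar> ^ m + \<bar>s j\<bar> ^ m)"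
        using abs_add_power_le[of "x - s j" "s j" m] by simp
      then have "\<bar>x\<bar> ^ m * \<bar>gauss_deriv k (x - s j)\<bar>
          \<le> 2 ^ m * (\<bar>x - s j\<bar> ^ m + \<bar>s j\<bar> ^ m) * \<bar>gauss_deriv k (x - s j)\<bar>"
        by (rule mult_right_mono) simp
      also have "\<dots> = 2 ^ m * (\<bar>x - s j\<bar> ^ m * \<bar>gauss_deriv k (x - s j)\<bar>)
          + 2 ^ m * \<bar>s j\<bar> ^ m * (\<bar>x - s j\<bar> ^ 0 * \<bar>gauss_deriv k (x - s j)\<bar>)"
        by (simp add: algebra_simps)
      also have "\<dots> \<le> 2 ^ m * A + 2 ^ m * \<bar>s j\<bar> ^ m * B"
        by (intro add_mono mult_left_mono A B) auto
      finally have "c j * (\<bar>x\<bar> ^ m * \<bar>gauss_deriv k (x - s j)\<bar>)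
          \<le> c j * (2 ^ m * A + 2 ^ m * \<bar>s j\<bar> ^ m * B)"
        by (rule mult_left_mono) (rule c)
      then show ?thesis
        using c[of j] by (simp add: t_def abs_mult power_abs algebra_simps)
    qed
    moreover have "summable ?M"
      by (intro summable_add summable_mult summ)
    ultimately show ?thesis by (intro exI[of _ ?M]) blast
  qed
  obtain M where M: "summable (M m k)" "\<bar>x ^ m * t k j x\<bar> \<le> M m k j" for m k j x
    using tb by metis
  have tsum: "summable (\<lambda>j. t k j x)" for k x
    by (rule summable_comparison_test[OF _ M(1)[of 0 k]]) (use M(2)[of x 0 k] in auto)
  show "summable (\<lambda>j. c j * gauss (x - s j))"
    using tsum[of 0 x] by (simp add: t_def)
  have "schwartz (h 0)"
  proof (rule schwartzI)
    fix k x
    have "uniformly_convergent_on UNIV (\<lambda>n x. \<Sum>j<n. t (Suc k) j x)"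
      by (rule Weierstrass_m_test'[OF _ M(1)[of 0 "Suc k"]]) (use M(2)[of _ 0 "Suc k"] in simp)
    moreover have "(t k j has_real_derivative t (Suc k) j x) (at x)" for j x
      unfolding t_def
      by (rule derivative_eq_intros DERIV_chain2[OF gauss_deriv_Suc] refl | simp)+
    ultimately show "(h k has_real_derivative h (Suc k) x) (at x)"
      unfolding h_def[abs_def]
      by (intro has_field_derivative_series'(2)[where S=UNIV and ?x0.0=x and f="t k"]) (auto simp: tsum)
  next
    fix m k
    have "\<bar>x ^ m * h k x\<bar> \<le> suminf (M m k)" for x
    proof -
      have "x ^ m * h k x = (\<Sum>j. x ^ m * t k j x)"
        unfolding h_def using tsum by (simp add: suminf_mult)
      also have "\<bar>\<dots>\<bar> \<le> suminf (M m k)"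
        using norm_suminf_le[OF _ M(1), of "\<lambda>j. x ^ m * t k j x"] M(2) by simp
      finally show ?thesis .
    qed
    then show "bounded (range (\<lambda>x. x ^ m * h k x))"
      unfolding bounded_iff by auto
  qed
  then show "schwartz (\<lambda>x. \<Sum>j. c j * gauss (x - s j))"
    by (simp add: h_def[abs_def] t_def)
qed

section \<open>Growth forced by convolvability\<close>

text \<open>Comparison with 1/(1 + t^2), whose primitive is arctan; the half line t < 0 is obtained
  by reflecting \<open>g\<close>.\<close>

lemma integrable_weight:
  assumes "p \<ge> 2"
  shows "integrable lborel (\<lambda>t::real. 1 / (1 + \<bar>t\<bar>) ^ p)"
proof -
  define g :: "real \<Rightarrow> real" where "g t = inverse (1 + t\<^sup>2) * indicator {0..} t" for t
  have [measurable]: "(\<lambda>t::real. inverse (1 + t\<^sup>2)) \<in> borel_measurable borel"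
    by measurable
  have "(\<integral>\<^sup>+t. ennreal (inverse (1 + t\<^sup>2)) * indicator {0..} t \<partial>lborel) = ennreal (pi / 2 - arctan 0)"
    by (rule nn_integral_FTC_atLeast) (auto intro!: derivative_eq_intros tendsto_arctan_at_top)
  moreover have "ennreal (norm (g t)) = ennreal (inverse (1 + t\<^sup>2)) * indicator {0..} t" for t
    by (auto simp: g_def indicator_def)
  ultimately have g: "integrable lborel g"
    unfolding integrable_iff_bounded by (auto simp: g_def[abs_def])
  have "integrable lborel (\<lambda>t. g t + g (0 + (-1) * t))"
    by (intro Bochner_Integration.integrable_add g lborel_integrable_real_affine) auto
  then show ?thesis
  proof (rule Bochner_Integration.integrable_bound)
    have 1: "1 / (1 + \<bar>t\<bar>) ^ p \<le> inverse (1 + t\<^sup>2)" for t :: real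
    proof -
      have "1 + t\<^sup>2 \<le> (1 + \<bar>t\<bar>)\<^sup>2"
        by (simp add: power2_eq_square algebra_simps)
      also have "\<dots> \<le> (1 + \<bar>t\<bar>) ^ p"
        using assms by (intro power_increasing) auto
      finally show ?thesis
        by (simp add: divide_inverse add_pos_nonneg)
    qed
    have 2: "inverse (1 + t\<^sup>2) \<le> g t + g (0 + (-1) * t)" for t
      by (auto simp: g_def indicator_def)
    have "norm (1 / (1 + \<bar>t\<bar>) ^ p) \<le> norm (g t + g (0 + (-1) * t))" for t
    proof -
      have "norm (1 / (1 + \<bar>t\<bar>) ^ p) = 1 / (1 + \<bar>t\<bar>) ^ p" by simp
      also have "\<dots> \<le> g t + g (0 + (-1) * t)" using 1 2 by (rule order_trans)
      also have "\<dots> \<le> norm (g t + g (0 + (-1) * t))" by simp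
      finally show ?thesis .
    qed
    then show "AE t in lborel. norm (1 / (1 + \<bar>t\<bar>) ^ p) \<le> norm (g t + g (0 + (-1) * t))"
      by simp
  qed measurable
qed

lemma schwartz_integrable:
  assumes "schwartz \<Phi>"
  shows "integrable lborel ((deriv ^^ k) \<Phi>)"
proof -
  obtain C where C: "C > 0" "\<And>x. \<bar>(deriv ^^ k) \<Phi> x\<bar> \<le> C / (1 + \<bar>x\<bar>) ^ 2"
    using schwartz_decay[OF assms] by blast
  have [measurable]: "(deriv ^^ k) \<Phi> \<in> borel_measurable borel"
    using schwartz_continuous[OF assms] by (rule borel_measurable_continuous_onI)
  have "integrable lborel (\<lambda>x::real. C * (1 / (1 + \<bar>x\<bar>) ^ 2))"
    by (intro integrable_mult_right integrable_weight) simp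
  then show ?thesis
  proof (rule Bochner_Integration.integrable_bound)
    show "AE x in lborel. norm ((deriv ^^ k) \<Phi> x) \<le> norm (C * (1 / (1 + \<bar>x\<bar>) ^ 2))"
      using C by auto
  qed simp
qed

lemma mollifier_normalize:
  assumes \<psi>: "schwartz \<psi>" and pos: "\<And>x. \<psi> x > 0"
  shows "(LBINT x. \<psi> x) > 0" and "mollifier (\<lambda>x. \<psi> x / (LBINT x. \<psi> x))"
proof -
  have int: "integrable lborel \<psi>"
    using schwartz_integrable[OF \<psi>, of 0] by simp
  have "(LBINT x. \<psi> x) \<noteq> 0"
  proof
    assume "(LBINT x. \<psi> x) = 0"
    then have "AE x in lborel. \<psi> x = 0"
      using integral_nonneg_eq_0_iff_AE[OF int] pos by (simp add: less_imp_le)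
    then have "AE x::real in lborel. False"
      using pos by (auto simp: less_le)
    then show False
      by (simp add: eventually_False ae_filter_eq_bot_iff)
  qed
  moreover have "(LBINT x. \<psi> x) \<ge> 0"
    using pos by (intro Bochner_Integration.integral_nonneg) (simp add: less_imp_le)
  ultimately show *: "(LBINT x. \<psi> x) > 0"
    by simp
  show "mollifier (\<lambda>x. \<psi> x / (LBINT x. \<psi> x))"
    using schwartz_scale[OF \<psi>, of 1 "1 / (LBINT x. \<psi> x)"] * by (simp add: mollifier_def)
qed

lemma mollifier_gauss_series:
  fixes c s :: "nat \<Rightarrow> real"
  assumes c: "\<And>j. c j > 0" and summ: "\<And>m. summable (\<lambda>j. c j * \<bar>s j\<bar> ^ m)"
  obtains J where "J > 0" "mollifier (\<lambda>x. (\<Sum>j. c j * gauss (x - s j)) / J)"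
proof -
  have "(\<Sum>j. c j * gauss (x - s j)) > 0" for x
    using schwartz_gauss_series(1)[of c s x] c summ
    by (intro suminf_pos) (auto simp: gauss_def less_imp_le)
  moreover have "schwartz (\<lambda>x. \<Sum>j. c j * gauss (x - s j))"
    using c summ by (intro schwartz_gauss_series(2)) (auto simp: less_imp_le)
  ultimately show ?thesis
    using that mollifier_normalize by blast
qed

text \<open>All centres are 0, so the series is a multiple of a single Gaussian, and normalizing it
  abstractly avoids evaluating the Gaussian integral.\<close>

lemma mollifier_exists: "\<exists>\<Phi>. mollifier \<Phi>"
proof -
  have "summable (\<lambda>j. (1 / 2) ^ j * \<bar>0::real\<bar> ^ m)" for m
    by (intro summable_mult2 summable_geometric) simp
  then show ?thesis
    by (rule mollifier_gauss_series[of "\<lambda>j. (1 / 2) ^ j" "\<lambda>_. 0", rotated]) auto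
qed

text \<open>If the Gaussian averages of \<open>\<bar>f\<bar>\<close> grew faster than every power, a Schwartz function
  \<open>\<Sum>j. c j * gauss (x - s j)\<close> not convolvable with \<open>f\<close> could be built by putting bumps where
  they are large; a polynomial bound for them yields the claim by Tonelli.\<close>

lemma moderate_growth:
  fixes f :: "real \<Rightarrow> real"
  assumes f: "continuous_on UNIV f"
    and conv: "\<And>\<Phi>. mollifier \<Phi> \<Longrightarrow> integrable lborel (\<lambda>y. f (- y) * \<Phi> y)"
  obtains p where "p \<ge> 2" "integrable lborel (\<lambda>t. \<bar>f t\<bar> / (1 + \<bar>t\<bar>) ^ p)"
proof -
  \<comment> \<open>The convolution at the point 0 pairs f(- y) with \<Phi>(y), hence the
    reflection. The absolute value may be inserted because integrability is absolute and the test
    functions are nonnegative.\<close>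
  define w where "w y = \<bar>f (- y)\<bar>" for y
  have wcont: "continuous_on UNIV w"
    unfolding w_def by (intro continuous_intros continuous_on_compose2[OF f]) auto
  then have [measurable]: "w \<in> borel_measurable borel"
    by (rule borel_measurable_continuous_onI)
  have [measurable]: "gauss \<in> borel_measurable borel"
    unfolding gauss_def[abs_def] by measurable
  have w: "integrable lborel (\<lambda>y. w y * \<psi> y)"
    if "mollifier (\<lambda>x. \<psi> x / J)" "J > 0" "\<And>x. \<psi> x \<ge> 0" for \<psi> :: "real \<Rightarrow> real" and J
  proof -
    have "integrable lborel (\<lambda>y. J * \<bar>f (- y) * (\<psi> y / J)\<bar>)"
      using integrable_abs[OF conv[OF that(1)]] by (rule integrable_mult_right)
    moreover have "J * \<bar>f (- y) * (\<psi> y / J)\<bar> = w y * \<psi> y" for y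
      using that(2,3) by (simp add: w_def abs_mult)
    ultimately show ?thesis by simp
  qed
  have series: "integrable lborel (\<lambda>y. w y * (\<Sum>j. c j * gauss (y - s j)))"
    if cs: "\<And>j. c j > 0" "\<And>m. summable (\<lambda>j. c j * \<bar>s j\<bar> ^ m)" for c s :: "nat \<Rightarrow> real"
  proof -
    obtain J where "J > 0" "mollifier (\<lambda>x. (\<Sum>j. c j * gauss (x - s j)) / J)"
      by (rule mollifier_gauss_series[OF cs])
    moreover have "(\<Sum>j. c j * gauss (x - s j)) \<ge> 0" for x
      using schwartz_gauss_series(1)[of c s x] cs
      by (intro suminf_nonneg) (auto simp: gauss_def less_imp_le)
    ultimately show ?thesis by (intro w) auto
  qed
  have term_le: "c i * gauss (x - s i) \<le> (\<Sum>j. c j * gauss (x - s j))"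
    if "\<And>j. c j > 0" "\<And>m. summable (\<lambda>j. c j * \<bar>s j\<bar> ^ m)" for c s :: "nat \<Rightarrow> real" and i x
  proof -
    have "(\<Sum>j\<in>{i}. c j * gauss (x - s j)) \<le> (\<Sum>j. c j * gauss (x - s j))"
      using schwartz_gauss_series(1)[of c s x] that
      by (intro sum_le_suminf) (auto simp: gauss_def less_imp_le)
    then show ?thesis by simp
  qed
  \<comment> \<open>A single bump is the term of index 0 of the series with all centres at
    \<open>s\<close>, so it inherits integrability from \<open>series\<close>.\<close>
  have wg: "integrable lborel (\<lambda>y. w y * gauss (y - s))" for s
  proof -
    have c: "\<And>j::nat. (1 / 2 :: real) ^ j > 0"
      and summ: "\<And>m. summable (\<lambda>j. (1 / 2) ^ j * \<bar>s\<bar> ^ m)"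
      by (auto intro!: summable_mult2 summable_geometric)
    show ?thesis
    proof (rule Bochner_Integration.integrable_bound[OF series[of "\<lambda>j. (1 / 2) ^ j" "\<lambda>_. s", OF c summ]])
      have "norm (w y * gauss (y - s)) \<le> norm (w y * (\<Sum>j. (1 / 2) ^ j * gauss (y - s)))" for y
        unfolding norm_mult
      proof (rule mult_left_mono)
        show "norm (gauss (y - s)) \<le> norm (\<Sum>j. (1 / 2) ^ j * gauss (y - s))"
          using term_le[of "\<lambda>j. (1 / 2) ^ j" "\<lambda>_. s" 0 y, OF c summ] by (simp add: gauss_def)
      qed simp
      then show "AE y in lborel. norm (w y * gauss (y - s)) \<le>
          norm (w y * (\<Sum>j. (1 / 2) ^ j * gauss (y - s)))"
        by simp
    qed measurable
  qed
  define A where "A s = (LBINT y. w y * gauss (y - s))" for s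
  have "\<exists>j. \<forall>s. A s \<le> real j * (2 + \<bar>s\<bar>) ^ j"
  proof (rule ccontr)
    assume "\<not> ?thesis"
    \<comment> \<open>The index j serves as constant and as exponent at once, so the failure of all
      polynomial bounds yields one sequence of centres.\<close>
    then obtain s where s: "\<And>j. A (s j) > real j * (2 + \<bar>s j\<bar>) ^ j"
      by (metis not_le)
    \<comment> \<open>The weight cancels the growth, so c_j A(s_j) > j, yet all its moments are
      finite: for j \<ge> m, m factors absorb \<bar>s_j\<bar>^m and each of the remaining ones is at
      least 2. The base 2 + \<bar>s_j\<bar> thus gives geometric decay even for centres near
      0.\<close>
    define c where "c j = inverse ((2 + \<bar>s j\<bar>) ^ j)" for j
    have c: "c j > 0" for j
      by (simp add: c_def add_pos_nonneg)
    have summ: "summable (\<lambda>j. c j * \<bar>s j\<bar> ^ m)" for m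
    proof (rule summable_comparison_test)
      have "norm (c j * \<bar>s j\<bar> ^ m) \<le> 2 ^ m * (1 / 2) ^ j" if "j \<ge> m" for j
      proof -
        have "(2 + \<bar>s j\<bar>) ^ j = (2 + \<bar>s j\<bar>) ^ m * (2 + \<bar>s j\<bar>) ^ (j - m)"
          using that by (simp flip: power_add)
        also have "\<dots> \<ge> \<bar>s j\<bar> ^ m * 2 ^ (j - m)"
          by (intro mult_mono power_mono) auto
        finally have "c j * (\<bar>s j\<bar> ^ m * 2 ^ (j - m)) \<le> c j * (2 + \<bar>s j\<bar>) ^ j"
          using c[of j] by (intro mult_left_mono) auto
        also have "c j * (2 + \<bar>s j\<bar>) ^ j = 1"
          unfolding c_def by (rule left_inverse) (auto simp: add_eq_0_iff)
        also have "c j * (\<bar>s j\<bar> ^ m * 2 ^ (j - m)) = c j * \<bar>s j\<bar> ^ m * 2 ^ j / 2 ^ m"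
          using that by (simp add: power_diff)
        finally show ?thesis
          using c[of j] by (simp add: power_divide pos_divide_le_eq pos_le_divide_eq)
      qed
      then show "\<exists>N. \<forall>j\<ge>N. norm (c j * \<bar>s j\<bar> ^ m) \<le> 2 ^ m * (1 / 2) ^ j"
        by blast
      show "summable (\<lambda>j. 2 ^ m * (1 / 2 :: real) ^ j)"
        by (intro summable_mult summable_geometric) simp
    qed
    let ?I = "LBINT y. w y * (\<Sum>j. c j * gauss (y - s j))"
    have "real i \<le> ?I" for i
    proof -
      have "real i \<le> c i * A (s i)"
      proof -
        have "c i * (real i * (2 + \<bar>s i\<bar>) ^ i) \<le> c i * A (s i)"
          using s[of i] c[of i] by (intro mult_left_mono) auto
        moreover have "c i * (2 + \<bar>s i\<bar>) ^ i = 1"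
          unfolding c_def by (rule left_inverse) (auto simp: add_eq_0_iff)
        ultimately show ?thesis
          by (metis mult.left_commute mult.right_neutral)
      qed
      also have "\<dots> = (LBINT y. w y * (c i * gauss (y - s i)))"
        unfolding A_def by (subst integral_mult_right_zero[symmetric]) (simp add: mult_ac)
      also have "\<dots> \<le> ?I"
      proof (rule integral_mono)
        show "integrable lborel (\<lambda>y. w y * (c i * gauss (y - s i)))"
          using integrable_mult_right[OF wg[of "s i"], of "c i"] by (simp add: mult.left_commute)
        show "integrable lborel (\<lambda>y. w y * (\<Sum>j. c j * gauss (y - s j)))"
          by (rule series[OF c summ])
        show "w y * (c i * gauss (y - s i)) \<le> w y * (\<Sum>j. c j * gauss (y - s j))" for y
          using term_le[of c s, OF c summ] by (intro mult_left_mono) (auto simp: w_def)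
      qed
      finally show ?thesis .
    qed
    then show False
      using reals_Archimedean2[of ?I] by (meson not_less)
  qed
  then obtain m where m: "\<And>s. A s \<le> real m * (2 + \<bar>s\<bar>) ^ m"
    by blast
  \<comment> \<open>Of the m + 2 powers, m cancel the bound on \<open>A\<close> and 2 are left to
    make the result integrable.\<close>
  define v where "v s = 1 / (2 + \<bar>s\<bar>) ^ (m + 2)" for s :: real
  have [measurable]: "v \<in> borel_measurable borel"
    unfolding v_def[abs_def] by measurable
  have "(\<integral>\<^sup>+s. \<integral>\<^sup>+y. ennreal (w y * gauss (y - s) * v s) \<partial>lborel \<partial>lborel)
      = (\<integral>\<^sup>+s. ennreal (A s * v s) \<partial>lborel)"
  proof (intro nn_integral_cong)
    fix s :: real
    have "(\<integral>\<^sup>+y. ennreal (w y * gauss (y - s) * v s) \<partial>lborel) = ennreal (LBINT y. w y * gauss (y - s) * v s)"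
      by (intro nn_integral_eq_integral integrable_mult_left wg)
        (auto simp: w_def gauss_def v_def)
    then show "(\<integral>\<^sup>+y. ennreal (w y * gauss (y - s) * v s) \<partial>lborel) = ennreal (A s * v s)"
      by (simp add: A_def)
  qed
  also have "\<dots> \<le> (\<integral>\<^sup>+s. ennreal (real m * (1 / (1 + \<bar>s\<bar>)\<^sup>2)) \<partial>lborel)"
  proof (intro nn_integral_mono ennreal_leI)
    fix s :: real
    have "A s * v s \<le> real m * (2 + \<bar>s\<bar>) ^ m * v s"
      by (intro mult_right_mono m) (auto simp: v_def)
    also have "\<dots> = real m * (1 / (2 + \<bar>s\<bar>)\<^sup>2)"
    proof -
      have "(2 + \<bar>s\<bar>) ^ m \<noteq> 0"
        by (simp add: add_eq_0_iff)
      then show ?thesis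
        unfolding v_def power_add by simp
    qed
    also have "\<dots> \<le> real m * (1 / (1 + \<bar>s\<bar>)\<^sup>2)"
      by (intro mult_left_mono divide_left_mono power_mono) (auto simp: add_pos_nonneg)
    finally show "A s * v s \<le> real m * (1 / (1 + \<bar>s\<bar>)\<^sup>2)" .
  qed
  also have "\<dots> < \<infinity>"
    using integrable_mult_right[OF integrable_weight[of 2], of "real m"]
    by (simp add: integrable_iff_bounded)
  also have "(\<integral>\<^sup>+s. \<integral>\<^sup>+y. ennreal (w y * gauss (y - s) * v s) \<partial>lborel \<partial>lborel)
      = (\<integral>\<^sup>+y. \<integral>\<^sup>+s. ennreal (w y * gauss (y - s) * v s) \<partial>lborel \<partial>lborel)"
    by (rule lborel_pair.Fubini') measurable
  finally have fin: "(\<integral>\<^sup>+y. \<integral>\<^sup>+s. ennreal (w y * gauss (y - s) * v s) \<partial>lborel \<partial>lborel) < \<infinity>" .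
  have "(\<integral>\<^sup>+y. ennreal (exp (-1) / 3 ^ (m + 2) * (w y / (1 + \<bar>y\<bar>) ^ (m + 2))) \<partial>lborel)
      \<le> (\<integral>\<^sup>+y. \<integral>\<^sup>+s. ennreal (w y * gauss (y - s) * v s) \<partial>lborel \<partial>lborel)"
  proof (rule nn_integral_mono)
    fix y :: real
    \<comment> \<open>Restricting the inner integral to s in [y, y + 1], an interval of length 1,
      gives the constant: there the Gaussian is at least exp(-1), and 2 + \<bar>s\<bar> \<le> 3 (1 +
      \<bar>y\<bar>).\<close>
    let ?a = "exp (-1) / 3 ^ (m + 2) * (w y / (1 + \<bar>y\<bar>) ^ (m + 2))"
    have "?a \<le> w y * gauss (y - s) * v s" if "s \<in> {y..y+1}" for s
    proof -
      have "(y - s)\<^sup>2 \<le> 1"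
        using that by (simp add: abs_square_le_1)
      then have 1: "exp (-1) \<le> gauss (y - s)"
        by (simp add: gauss_def)
      have "(2 + \<bar>s\<bar>) ^ (m + 2) \<le> (3 * (1 + \<bar>y\<bar>)) ^ (m + 2)"
        using that by (intro power_mono) auto
      then have 2: "1 / (3 * (1 + \<bar>y\<bar>)) ^ (m + 2) \<le> v s"
        unfolding v_def by (intro divide_left_mono) (auto simp: add_pos_nonneg)
      have "?a = w y * exp (-1) * (1 / (3 * (1 + \<bar>y\<bar>)) ^ (m + 2))"
        unfolding power_mult_distrib
        by (simp only: divide_inverse inverse_mult_distrib mult_ac mult_1_left)
      also have "\<dots> \<le> w y * gauss (y - s) * v s"
        by (intro mult_mono 1 2) (auto simp: w_def gauss_def)
      finally show ?thesis .
    qed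
    then have "(\<integral>\<^sup>+s. ennreal ?a * indicator {y..y+1} s \<partial>lborel)
        \<le> (\<integral>\<^sup>+s. ennreal (w y * gauss (y - s) * v s) \<partial>lborel)"
      by (intro nn_integral_mono) (auto simp: indicator_def intro!: ennreal_leI)
    then show "ennreal ?a \<le> (\<integral>\<^sup>+s. ennreal (w y * gauss (y - s) * v s) \<partial>lborel)"
      by (simp add: nn_integral_cmult_indicator)
  qed
  then have lt: "(\<integral>\<^sup>+y. ennreal (exp (-1) / 3 ^ (m + 2) * (w y / (1 + \<bar>y\<bar>) ^ (m + 2))) \<partial>lborel) < \<infinity>"
    using fin by (rule le_less_trans)
  have "integrable lborel (\<lambda>y. exp (-1) / 3 ^ (m + 2) * (w y / (1 + \<bar>y\<bar>) ^ (m + 2)))"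
    unfolding integrable_iff_bounded
  proof (intro conjI)
    show "(\<lambda>y. exp (-1) / 3 ^ (m + 2) * (w y / (1 + \<bar>y\<bar>) ^ (m + 2))) \<in> borel_measurable lborel"
      by measurable
    have "w y \<ge> 0" for y
      by (simp add: w_def)
    then have "norm (exp (-1) / 3 ^ (m + 2) * (w y / (1 + \<bar>y\<bar>) ^ (m + 2)))
        = exp (-1) / 3 ^ (m + 2) * (w y / (1 + \<bar>y\<bar>) ^ (m + 2))" for y
      by simp
    then show "(\<integral>\<^sup>+y. ennreal (norm (exp (-1) / 3 ^ (m + 2) * (w y / (1 + \<bar>y\<bar>) ^ (m + 2)))) \<partial>lborel) < \<infinity>"
      using lt by (simp only:)
  qed
  then have "integrable lborel (\<lambda>y. w y / (1 + \<bar>y\<bar>) ^ (m + 2))"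
    using integrable_mult_left_iff[of lborel "exp (-1) / 3 ^ (m + 2)" "\<lambda>y. w y / (1 + \<bar>y\<bar>) ^ (m + 2)"]
    by simp
  then have "integrable lborel (\<lambda>t. w (0 + (-1) * t) / (1 + \<bar>0 + (-1) * t\<bar>) ^ (m + 2))"
    by (rule lborel_integrable_real_affine) simp
  then show ?thesis
    by (intro that[of "m + 2"]) (auto simp: w_def)
qed

section \<open>Mollification\<close>

text \<open>In this form the variable x occurs only in the second factor, so that derivatives fall
  on the mollifier and the first factor needs only continuity and growth.\<close>

lemma convolution_altdef: "convolution f g x = (LBINT t. f t * g (x - t))"
  unfolding convolution_def
  by (subst lborel_integral_real_affine[where c="-1" and t=x]) simp_all

lemma convolution_integrable_iff:
  fixes f g :: "real \<Rightarrow> real"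
  shows "integrable lborel (\<lambda>y. f (x - y) * g y) \<longleftrightarrow> integrable lborel (\<lambda>t. f t * g (x - t))"
  using lborel_integrable_real_affine_iff[of "-1" "\<lambda>y. f (x - y) * g y" x] by simp

text \<open>Peetre's inequality: 1 + \<bar>t\<bar> \<le> (1 + \<bar>x\<bar>) (1 + \<bar>x -
  t\<bar>). It turns growth control centred at 0 into control centred at x, locally uniformly in
  x.\<close>

lemma weight_shift:
  fixes x t :: real
  shows "1 / (1 + \<bar>x - t\<bar>) ^ p \<le> (1 + \<bar>x\<bar>) ^ p * (1 / (1 + \<bar>t\<bar>) ^ p)"
proof -
  have "1 + \<bar>t\<bar> \<le> 1 + (\<bar>x\<bar> + \<bar>x - t\<bar>)" by arith
  also have "\<dots> \<le> (1 + \<bar>x\<bar>) * (1 + \<bar>x - t\<bar>)"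
    by (simp add: algebra_simps)
  finally have "(1 + \<bar>t\<bar>) ^ p \<le> (1 + \<bar>x\<bar>) ^ p * (1 + \<bar>x - t\<bar>) ^ p"
    by (subst power_mult_distrib[symmetric]) (rule power_mono, auto)
  then show ?thesis
    by (simp add: add_pos_nonneg pos_divide_le_eq pos_le_divide_eq mult.commute)
qed

lemma convolution_weight:
  fixes f :: "real \<Rightarrow> real"
  assumes f: "continuous_on UNIV f" and fp: "integrable lborel (\<lambda>t. \<bar>f t\<bar> / (1 + \<bar>t\<bar>) ^ p)"
  shows "integrable lborel (\<lambda>t. \<bar>f t\<bar> * (1 / (1 + \<bar>x - t\<bar>) ^ p))" (is "integrable _ ?h")
    and "(LBINT t. \<bar>f t\<bar> * (1 / (1 + \<bar>x - t\<bar>) ^ p))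
      \<le> (1 + \<bar>x\<bar>) ^ p * (LBINT t. \<bar>f t\<bar> / (1 + \<bar>t\<bar>) ^ p)"
proof -
  have [measurable]: "f \<in> borel_measurable borel"
    using f by (rule borel_measurable_continuous_onI)
  have le: "?h t \<le> (1 + \<bar>x\<bar>) ^ p * (\<bar>f t\<bar> / (1 + \<bar>t\<bar>) ^ p)" for t
    using mult_left_mono[OF weight_shift[of x t p] abs_ge_zero[of "f t"]] by (simp add: mult_ac)
  have int: "integrable lborel (\<lambda>t. (1 + \<bar>x\<bar>) ^ p * (\<bar>f t\<bar> / (1 + \<bar>t\<bar>) ^ p))"
    by (intro integrable_mult_right fp)
  show h: "integrable lborel ?h"
  proof (rule Bochner_Integration.integrable_bound[OF int])
    have "norm (?h t) \<le> norm ((1 + \<bar>x\<bar>) ^ p * (\<bar>f t\<bar> / (1 + \<bar>t\<bar>) ^ p))" for t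
      using le[of t] by simp
    then show "AE t in lborel. norm (?h t) \<le> norm ((1 + \<bar>x\<bar>) ^ p * (\<bar>f t\<bar> / (1 + \<bar>t\<bar>) ^ p))"
      by blast
  qed measurable
  have "(LBINT t. ?h t) \<le> (LBINT t. (1 + \<bar>x\<bar>) ^ p * (\<bar>f t\<bar> / (1 + \<bar>t\<bar>) ^ p))"
    using le by (intro integral_mono h int)
  then show "(LBINT t. ?h t) \<le> (1 + \<bar>x\<bar>) ^ p * (LBINT t. \<bar>f t\<bar> / (1 + \<bar>t\<bar>) ^ p)"
    by (simp only: integral_mult_right_zero)
qed

lemma convolution_integrable:
  fixes f g :: "real \<Rightarrow> real"
  assumes f: "continuous_on UNIV f" and fp: "integrable lborel (\<lambda>t. \<bar>f t\<bar> / (1 + \<bar>t\<bar>) ^ p)"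
    and g: "schwartz \<Phi>"
  shows "integrable lborel (\<lambda>t. f t * (deriv ^^ k) \<Phi> (x - t))"
proof -
  have [measurable]: "f \<in> borel_measurable borel" "(deriv ^^ k) \<Phi> \<in> borel_measurable borel"
    using f schwartz_continuous[OF g] by (auto intro: borel_measurable_continuous_onI)
  obtain C where C: "C > 0" "\<And>x. \<bar>(deriv ^^ k) \<Phi> x\<bar> \<le> C / (1 + \<bar>x\<bar>) ^ p"
    using schwartz_decay[OF g, of k p] by blast
  have "integrable lborel (\<lambda>t. C * (\<bar>f t\<bar> * (1 / (1 + \<bar>x - t\<bar>) ^ p)))"
    by (intro integrable_mult_right convolution_weight[OF f fp])
  then show ?thesis
  proof (rule Bochner_Integration.integrable_bound)
    have "norm (f t * (deriv ^^ k) \<Phi> (x - t)) \<le> norm (C * (\<bar>f t\<bar> * (1 / (1 + \<bar>x - t\<bar>) ^ p)))" for t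
      using mult_left_mono[OF C(2)[of "x - t"] abs_ge_zero[of "f t"]] C(1)
      by (simp add: abs_mult mult_ac)
    then show "AE t in lborel. norm (f t * (deriv ^^ k) \<Phi> (x - t))
        \<le> norm (C * (\<bar>f t\<bar> * (1 / (1 + \<bar>x - t\<bar>) ^ p)))"
      by blast
  qed measurable
qed

text \<open>Two uses of the mean value inequality, one for g' and one for g minus its linear part.
  The constant B, twice that of Taylor's formula, costs nothing below.\<close>

lemma second_order_bound:
  fixes g :: "real \<Rightarrow> real"
  assumes g: "\<And>u. (g has_real_derivative g' u) (at u)" "\<And>u. (g' has_real_derivative g'' u) (at u)"
    and B: "\<And>u. \<bar>u - z\<bar> \<le> \<bar>h\<bar> \<Longrightarrow> \<bar>g'' u\<bar> \<le> B"
  shows "\<bar>g (z + h) - g z - h * g' z\<bar> \<le> B * h\<^sup>2"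
proof -
  have 1: "\<bar>g' u - g' z\<bar> \<le> B * \<bar>h\<bar>" if "u \<in> cball z \<bar>h\<bar>" for u
  proof -
    have "norm (g' u - g' z) \<le> B * norm (u - z)"
      by (rule field_differentiable_bound[where S="cball z \<bar>h\<bar>" and f'=g''])
        (use that B g in \<open>auto simp: dist_real_def abs_minus_commute intro: has_field_derivative_at_within\<close>)
    also have "\<dots> \<le> B * \<bar>h\<bar>"
      using that B[of z] by (intro mult_left_mono) (auto simp: dist_real_def abs_minus_commute)
    finally show ?thesis by simp
  qed
  have "norm ((g (z + h) - (z + h) * g' z) - (g z - z * g' z)) \<le> (B * \<bar>h\<bar>) * norm ((z + h) - z)"
  proof (rule field_differentiable_bound[where S="cball z \<bar>h\<bar>" and f'="\<lambda>u. g' u - g' z"])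
    show "((\<lambda>u. g u - u * g' z) has_field_derivative g' u - g' z) (at u within cball z \<bar>h\<bar>)" for u
      by (rule derivative_eq_intros has_field_derivative_at_within[OF g(1)] refl | simp)+
  qed (use 1 in \<open>auto simp: dist_real_def\<close>)
  then show ?thesis
    by (simp add: power2_eq_square algebra_simps abs_mult_self_eq)
qed

text \<open>The second order remainder of the kernel is integrated against \<bar>f\<bar>. The decay
  of the second derivative of the kernel matches the weight of \<open>f\<close>, so the remainder of
  the convolution is at most K h^2 and the difference quotients converge.\<close>

lemma convolution_has_derivative:
  fixes f :: "real \<Rightarrow> real"
  assumes f: "continuous_on UNIV f" and fp: "integrable lborel (\<lambda>t. \<bar>f t\<bar> / (1 + \<bar>t\<bar>) ^ p)"
    and \<Phi>: "schwartz \<Phi>"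
  shows "(convolution f ((deriv ^^ k) \<Phi>) has_real_derivative
    convolution f ((deriv ^^ Suc k) \<Phi>) x) (at x)"
proof -
  let ?g = "(deriv ^^ k) \<Phi>" and ?g' = "(deriv ^^ Suc k) \<Phi>" and ?g'' = "(deriv ^^ Suc (Suc k)) \<Phi>"
  obtain C where C: "C > 0" "\<And>x. \<bar>?g'' x\<bar> \<le> C / (1 + \<bar>x\<bar>) ^ p"
    using schwartz_decay[OF \<Phi>, of "Suc (Suc k)" p] by blast
  define K where "K = C * 2 ^ p * ((1 + \<bar>x\<bar>) ^ p * (LBINT t. \<bar>f t\<bar> / (1 + \<bar>t\<bar>) ^ p))"
  \<comment> \<open>The factor 2^p pays for moving the weight from the intermediate point u to z:
    \<bar>u - z\<bar> \<le> 1 gives 1 + \<bar>z\<bar> \<le> 2 (1 + \<bar>u\<bar>).\<close>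
  have g: "\<bar>?g (z + h) - ?g z - h * ?g' z\<bar> \<le> C * 2 ^ p * (1 / (1 + \<bar>z\<bar>) ^ p) * h\<^sup>2" if "\<bar>h\<bar> \<le> 1" for z h
  proof (rule second_order_bound[where g''="?g''"])
    fix u :: real
    assume u: "\<bar>u - z\<bar> \<le> \<bar>h\<bar>"
    have "(1 + \<bar>z\<bar>) ^ p \<le> (2 * (1 + \<bar>u\<bar>)) ^ p"
      using u that by (intro power_mono) auto
    then have "(1 + \<bar>z\<bar>) ^ p \<le> 2 ^ p * (1 + \<bar>u\<bar>) ^ p"
      by (simp only: power_mult_distrib)
    then have "C / (1 + \<bar>u\<bar>) ^ p \<le> C * 2 ^ p * (1 / (1 + \<bar>z\<bar>) ^ p)"
      using C(1) by (simp add: add_pos_nonneg pos_divide_le_eq pos_le_divide_eq mult_ac)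
    then show "\<bar>?g'' u\<bar> \<le> C * 2 ^ p * (1 / (1 + \<bar>z\<bar>) ^ p)"
      using C(2)[of u] by linarith
  qed (rule schwartz_deriv[OF \<Phi>])+
  let ?c = "convolution f ?g" and ?c' = "convolution f ?g'"
  have quad: "\<bar>?c (x + h) - ?c x - h * ?c' x\<bar> \<le> K * h\<^sup>2" if "\<bar>h\<bar> \<le> 1" for h
  proof -
    let ?d = "\<lambda>t. f t * (?g (x + h - t) - ?g (x - t) - h * ?g' (x - t))"
    have int: "integrable lborel (\<lambda>t. f t * (deriv ^^ j) \<Phi> (y - t))" for j y
      by (rule convolution_integrable[OF f fp \<Phi>])
    have "?c (x + h) - ?c x - h * ?c' x
        = (LBINT t. f t * ?g (x + h - t)) - (LBINT t. f t * ?g (x - t)) - (LBINT t. h * (f t * ?g' (x - t)))"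
      by (simp only: convolution_altdef integral_mult_right_zero)
    also have "\<dots> = (LBINT t. f t * ?g (x + h - t) - f t * ?g (x - t) - h * (f t * ?g' (x - t)))"
      by (simp only: Bochner_Integration.integral_diff[OF int int] Bochner_Integration.integral_diff[OF
            Bochner_Integration.integrable_diff[OF int int] integrable_mult_right[OF int]])
    also have "\<dots> = (LBINT t. ?d t)"
      by (simp only: right_diff_distrib mult.left_commute)
    finally have "\<bar>?c (x + h) - ?c x - h * ?c' x\<bar> = \<bar>LBINT t. ?d t\<bar>"
      by (simp only:)
    also have "\<dots> \<le> (LBINT t. C * 2 ^ p * h\<^sup>2 * (\<bar>f t\<bar> * (1 / (1 + \<bar>x - t\<bar>) ^ p)))"
    proof (rule order_trans[OF integral_abs_bound integral_mono])
      have "integrable lborel (\<lambda>t. f t * ?g (x + h - t) - f t * ?g (x - t) - h * (f t * ?g' (x - t)))"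
        by (intro int Bochner_Integration.integrable_diff integrable_mult_right)
      then show "integrable lborel (\<lambda>t. \<bar>?d t\<bar>)"
        by (intro integrable_abs) (simp only: right_diff_distrib mult.left_commute)
      show "integrable lborel (\<lambda>t. C * 2 ^ p * h\<^sup>2 * (\<bar>f t\<bar> * (1 / (1 + \<bar>x - t\<bar>) ^ p)))"
        by (intro integrable_mult_right convolution_weight[OF f fp])
      show "\<bar>?d t\<bar> \<le> C * 2 ^ p * h\<^sup>2 * (\<bar>f t\<bar> * (1 / (1 + \<bar>x - t\<bar>) ^ p))" for t
      proof -
        have "\<bar>?d t\<bar> = \<bar>f t\<bar> * \<bar>?g ((x - t) + h) - ?g (x - t) - h * ?g' (x - t)\<bar>"
        proof -
          have "x + h - t = (x - t) + h" by simp
          then show ?thesis by (simp only: abs_mult)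
        qed
        also have "\<dots> \<le> \<bar>f t\<bar> * (C * 2 ^ p * (1 / (1 + \<bar>x - t\<bar>) ^ p) * h\<^sup>2)"
          by (intro mult_left_mono g that) simp
        finally show ?thesis by (simp add: mult_ac)
      qed
    qed
    also have "\<dots> = C * 2 ^ p * h\<^sup>2 * (LBINT t. \<bar>f t\<bar> * (1 / (1 + \<bar>x - t\<bar>) ^ p))"
      by (rule integral_mult_right_zero)
    also have "\<dots> \<le> C * 2 ^ p * h\<^sup>2 * ((1 + \<bar>x\<bar>) ^ p * (LBINT t. \<bar>f t\<bar> / (1 + \<bar>t\<bar>) ^ p))"
      using C(1) by (intro mult_left_mono convolution_weight[OF f fp]) auto
    finally show ?thesis by (simp add: K_def mult_ac)
  qed
  have "((\<lambda>h. (?c (x + h) - ?c x) / h - ?c' x) \<longlongrightarrow> 0) (at 0)"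
  proof (rule Lim_null_comparison)
    show "((\<lambda>h. K * \<bar>h\<bar>) \<longlongrightarrow> 0) (at 0)"
      by (auto intro!: tendsto_eq_intros)
    have "norm ((?c (x + h) - ?c x) / h - ?c' x) \<le> K * \<bar>h\<bar>" if "h \<noteq> 0" "dist h 0 < 1" for h
    proof -
      have "(?c (x + h) - ?c x) / h - ?c' x = (?c (x + h) - ?c x - h * ?c' x) / h"
        using that by (simp add: field_simps)
      also have "norm \<dots> \<le> K * h\<^sup>2 / \<bar>h\<bar>"
        using quad[of h] that by (simp add: divide_right_mono)
      also have "\<dots> = K * \<bar>h\<bar>"
        using that by (cases "h > 0") (simp_all add: power2_eq_square)
      finally show ?thesis .
    qed
    then show "\<forall>\<^sub>F h in at 0. norm ((?c (x + h) - ?c x) / h - ?c' x) \<le> K * \<bar>h\<bar>"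
      unfolding eventually_at by (intro exI[of _ 1]) auto
  qed
  then show ?thesis
    unfolding DERIV_def by (rule LIM_zero_cancel)
qed

section \<open>Rescaled mollifiers as an approximate identity\<close>

lemma rescale_mollifier:
  assumes \<Phi>: "mollifier \<Phi>" and n: "n \<ge> 1"
  shows "schwartz (rescale \<Phi> n)" "(LBINT y. rescale \<Phi> n y) = 1"
    "(LBINT y. \<bar>rescale \<Phi> n y\<bar>) = (LBINT y. \<bar>\<Phi> y\<bar>)"
proof -
  show "schwartz (rescale \<Phi> n)"
    using schwartz_scale[of \<Phi> "real n" "real n"] \<Phi> n by (simp add: mollifier_def rescale_def[abs_def])
  show "(LBINT y. rescale \<Phi> n y) = 1"
    using lborel_integral_real_affine[of "real n" \<Phi> 0] \<Phi> n
    by (simp add: mollifier_def rescale_def)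
  show "(LBINT y. \<bar>rescale \<Phi> n y\<bar>) = (LBINT y. \<bar>\<Phi> y\<bar>)"
    using lborel_integral_real_affine[of "real n" "\<lambda>y. \<bar>\<Phi> y\<bar>" 0] n
    by (simp add: rescale_def abs_mult)
qed

text \<open>For \<bar>y\<bar> \<ge> \<delta> with \<delta> \<le> 1 one has n \<bar>y\<bar> \<ge> n
  \<delta>/2 (1 + \<bar>y\<bar>). Rescaling costs a factor n and the decay returns at least n^2, as
  p \<ge> 2; so 1/n remains, together with the full weight needed to integrate against
  \<open>f\<close>.\<close>

lemma rescale_tail:
  assumes C: "C > 0" "\<And>x. \<bar>\<Phi> x\<bar> \<le> C / (1 + \<bar>x\<bar>) ^ p" and p: "p \<ge> 2" and n: "n \<ge> 1"
    and \<delta>: "0 < \<delta>" "\<delta> \<le> 1" "\<delta> \<le> \<bar>y\<bar>"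
  shows "\<bar>rescale \<Phi> n y\<bar> \<le> C / (\<delta> / 2) ^ p / real n * (1 / (1 + \<bar>y\<bar>) ^ p)"
proof -
  have "\<delta> / 2 * (1 + \<bar>y\<bar>) \<le> \<bar>y\<bar>"
    using mult_right_mono[OF \<delta>(2), of "\<bar>y\<bar>"] \<delta> by (simp add: algebra_simps)
  then have "real n * (\<delta> / 2 * (1 + \<bar>y\<bar>)) \<le> real n * \<bar>y\<bar>"
    by (rule mult_left_mono) simp
  also have "\<dots> \<le> 1 + \<bar>real n * y\<bar>"
    by (simp add: abs_mult)
  finally have "(real n * (\<delta> / 2 * (1 + \<bar>y\<bar>))) ^ p \<le> (1 + \<bar>real n * y\<bar>) ^ p"
    using \<delta> by (intro power_mono) auto
  moreover have "(real n)\<^sup>2 * (\<delta> / 2 * (1 + \<bar>y\<bar>)) ^ p \<le> (real n * (\<delta> / 2 * (1 + \<bar>y\<bar>))) ^ p"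
    unfolding power_mult_distrib[of "real n"]
    using n p \<delta> by (intro mult_right_mono power_increasing) auto
  ultimately have le: "(real n)\<^sup>2 * (\<delta> / 2 * (1 + \<bar>y\<bar>)) ^ p \<le> (1 + \<bar>real n * y\<bar>) ^ p"
    by linarith
  have pos: "(real n)\<^sup>2 * (\<delta> / 2 * (1 + \<bar>y\<bar>)) ^ p > 0"
    using n \<delta> by (intro mult_pos_pos zero_less_power) (auto simp: add_pos_nonneg)
  have "\<bar>rescale \<Phi> n y\<bar> \<le> real n * (C / (1 + \<bar>real n * y\<bar>) ^ p)"
    using mult_left_mono[OF C(2)[of "real n * y"], of "real n"] by (simp add: rescale_def abs_mult)
  also have "\<dots> \<le> real n * (C / ((real n)\<^sup>2 * (\<delta> / 2 * (1 + \<bar>y\<bar>)) ^ p))"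
    using le pos C(1) by (intro mult_left_mono divide_left_mono) (auto simp: add_pos_nonneg)
  also have "\<dots> = C / (\<delta> / 2) ^ p / real n * (1 / (1 + \<bar>y\<bar>) ^ p)"
    using n unfolding power_mult_distrib[of "\<delta> / 2"] by (simp add: power2_eq_square)
  finally show ?thesis .
qed

text \<open>Near y = 0 uniform continuity of \<open>f\<close> is used, elsewhere the tail bound. As
  \<open>f\<close> may be unbounded and \<Phi> may change sign, the far part is measured in the
  weight and the near part against the integral of \<bar>\<Phi>\<bar>, which rescaling
  preserves.\<close>

lemma convolution_rescale_uniform_limit:
  fixes f :: "real \<Rightarrow> real"
  assumes f: "continuous_on UNIV f" and fp: "integrable lborel (\<lambda>t. \<bar>f t\<bar> / (1 + \<bar>t\<bar>) ^ p)"
    and p: "p \<ge> 2" and \<Phi>: "mollifier \<Phi>"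
  shows "uniform_limit {-R..R} (\<lambda>n. convolution f (rescale \<Phi> n)) f sequentially"
proof (rule uniform_limitI)
  fix \<epsilon> :: real
  assume \<epsilon>: "\<epsilon> > 0"
  have S: "schwartz \<Phi>" using \<Phi> by (simp add: mollifier_def)
  define I where "I = (LBINT y. \<bar>\<Phi> y\<bar>)"
  have I: "I \<ge> 0" unfolding I_def by (rule Bochner_Integration.integral_nonneg) simp
  obtain C where C: "C > 0" "\<And>x. \<bar>\<Phi> x\<bar> \<le> C / (1 + \<bar>x\<bar>) ^ p"
    using schwartz_decay[OF S, of 0 p] by auto
  have "bounded (f ` {-R..R})"
    by (intro compact_imp_bounded compact_continuous_image continuous_on_subset[OF f]) auto
  then obtain B where B: "B > 0" "\<And>x. x \<in> {-R..R} \<Longrightarrow> \<bar>f x\<bar> \<le> B"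
    unfolding bounded_pos by auto
  \<comment> \<open>Chosen for e * I \<le> \<epsilon>/2; the summand 1 makes the denominator
    positive without a lower bound on \<open>I\<close>.\<close>
  define e where "e = \<epsilon> / (2 * (I + 1))"
  have e: "e > 0" using \<epsilon> I by (simp add: e_def)
  have "uniformly_continuous_on {-R-1..R+1} f"
    by (intro compact_uniformly_continuous continuous_on_subset[OF f]) auto
  then obtain d where d: "d > 0"
    "\<And>x x'. x \<in> {-R-1..R+1} \<Longrightarrow> x' \<in> {-R-1..R+1} \<Longrightarrow> dist x' x < d \<Longrightarrow> dist (f x') (f x) < e"
    unfolding uniformly_continuous_on_def using e by metis
  \<comment> \<open>The cap 1 keeps x - y inside [-R-1, R+1], where \<open>f\<close> is uniformly
    continuous, and is also required by \<open>rescale_tail\<close>.\<close>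
  define \<delta> where "\<delta> = min d 1"
  have \<delta>: "0 < \<delta>" "\<delta> \<le> 1" using d by (auto simp: \<delta>_def)
  define D where "D = C / (\<delta> / 2) ^ p"
  have D: "D > 0" using C \<delta> by (simp add: D_def)
  define W where "W = (LBINT t::real. 1 / (1 + \<bar>t\<bar>) ^ p)"
  define K where "K = (1 + \<bar>R\<bar>) ^ p * (LBINT t. \<bar>f t\<bar> / (1 + \<bar>t\<bar>) ^ p) + B * W"
  have main: "\<bar>convolution f (rescale \<Phi> n) x - f x\<bar> \<le> e * I + D / real n * K"
    if x: "x \<in> {-R..R}" and n: "n \<ge> 1" for x n
  proof -
    let ?P = "rescale \<Phi> n"
    note r = rescale_mollifier[OF \<Phi> n]
    have Pint: "integrable lborel ?P"
      using schwartz_integrable[OF r(1), of 0] by simp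
    have cint: "integrable lborel (\<lambda>y. f (x - y) * ?P y)"
      unfolding convolution_integrable_iff using convolution_integrable[OF f fp r(1), of 0] by simp
    have wint: "integrable lborel (\<lambda>y. \<bar>f (x - y)\<bar> * (1 / (1 + \<bar>y\<bar>) ^ p))"
      using convolution_weight(1)[OF f fp, of x]
        convolution_integrable_iff[of "\<lambda>t. \<bar>f t\<bar>" x "\<lambda>y. 1 / (1 + \<bar>y\<bar>) ^ p"] by simp
    \<comment> \<open>One majorant for both regions: its first summand dominates near 0, its second
      away from 0, so the integral never has to be split.\<close>
    let ?b = "\<lambda>y. e * \<bar>?P y\<bar> + D / real n * (\<bar>f (x - y)\<bar> * (1 / (1 + \<bar>y\<bar>) ^ p) + B * (1 / (1 + \<bar>y\<bar>) ^ p))"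
    have "convolution f ?P x - f x = (LBINT y. f (x - y) * ?P y) - (LBINT y. f x * ?P y)"
      using r(2) by (simp add: convolution_def)
    also have "\<dots> = (LBINT y. f (x - y) * ?P y - f x * ?P y)"
      by (rule Bochner_Integration.integral_diff[symmetric]) (intro cint integrable_mult_right Pint)+
    finally have "\<bar>convolution f ?P x - f x\<bar> = \<bar>LBINT y. f (x - y) * ?P y - f x * ?P y\<bar>"
      by (simp only:)
    also have "\<dots> \<le> (LBINT y. ?b y)"
    proof (rule order_trans[OF integral_abs_bound integral_mono])
      show "integrable lborel (\<lambda>y. \<bar>f (x - y) * ?P y - f x * ?P y\<bar>)"
        by (intro integrable_abs Bochner_Integration.integrable_diff cint integrable_mult_right Pint)
      show "integrable lborel ?b"
        by (intro Bochner_Integration.integrable_add integrable_mult_right integrable_abs Pint wint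
            integrable_weight p)
      show "\<bar>f (x - y) * ?P y - f x * ?P y\<bar> \<le> ?b y" for y
      proof (cases "\<bar>y\<bar> < \<delta>")
        case True
        then have "dist (f (x - y)) (f x) < e"
          using x by (intro d(2)) (auto simp: \<delta>_def dist_real_def)
        then have "\<bar>f (x - y) - f x\<bar> * \<bar>?P y\<bar> \<le> e * \<bar>?P y\<bar>"
          by (intro mult_right_mono) (auto simp: dist_real_def)
        moreover have "0 \<le> D / real n * (\<bar>f (x - y)\<bar> * (1 / (1 + \<bar>y\<bar>) ^ p) + B * (1 / (1 + \<bar>y\<bar>) ^ p))"
          using D B by simp
        ultimately show ?thesis
          by (simp add: left_diff_distrib[symmetric] abs_mult)
      next
        case False
        have "\<bar>f (x - y) - f x\<bar> * \<bar>?P y\<bar> \<le> (\<bar>f (x - y)\<bar> + B) * (D / real n * (1 / (1 + \<bar>y\<bar>) ^ p))"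
        proof (rule mult_mono)
          show "\<bar>f (x - y) - f x\<bar> \<le> \<bar>f (x - y)\<bar> + B"
            using B(2)[OF x] abs_triangle_ineq4[of "f (x - y)" "f x"] by linarith
          show "\<bar>?P y\<bar> \<le> D / real n * (1 / (1 + \<bar>y\<bar>) ^ p)"
            unfolding D_def by (rule rescale_tail[OF C p n \<delta>]) (use False in simp)
        qed (use B(1) in auto)
        also have "\<dots> = D / real n * (\<bar>f (x - y)\<bar> * (1 / (1 + \<bar>y\<bar>) ^ p) + B * (1 / (1 + \<bar>y\<bar>) ^ p))"
          by (simp add: algebra_simps add_divide_distrib)
        also have "\<dots> \<le> ?b y"
          using e by simp
        finally show ?thesis
          by (simp add: left_diff_distrib[symmetric] abs_mult)
      qed
    qed
    also have "\<dots> = e * (LBINT y. \<bar>?P y\<bar>)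
        + D / real n * ((LBINT y. \<bar>f (x - y)\<bar> * (1 / (1 + \<bar>y\<bar>) ^ p)) + B * W)"
    proof -
      have P: "integrable lborel (\<lambda>y. e * \<bar>?P y\<bar>)"
        by (intro integrable_mult_right integrable_abs Pint)
      have w: "integrable lborel (\<lambda>y::real. B * (1 / (1 + \<bar>y\<bar>) ^ p))"
        by (intro integrable_mult_right integrable_weight p)
      show ?thesis
        unfolding Bochner_Integration.integral_add[OF P integrable_mult_right[OF
              Bochner_Integration.integrable_add[OF wint w]]]
          integral_mult_right_zero Bochner_Integration.integral_add[OF wint w] W_def ..
    qed
    finally have 1: "\<bar>convolution f ?P x - f x\<bar>
        \<le> e * I + D / real n * ((LBINT y. \<bar>f (x - y)\<bar> * (1 / (1 + \<bar>y\<bar>) ^ p)) + B * W)"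
      by (simp only: I_def r(3))
    have "(LBINT y. \<bar>f (x - y)\<bar> * (1 / (1 + \<bar>y\<bar>) ^ p)) = (LBINT t. \<bar>f t\<bar> * (1 / (1 + \<bar>x - t\<bar>) ^ p))"
      using convolution_altdef[of "\<lambda>t. \<bar>f t\<bar>" "\<lambda>y. 1 / (1 + \<bar>y\<bar>) ^ p" x] by (simp add: convolution_def)
    also have "\<dots> \<le> (1 + \<bar>x\<bar>) ^ p * (LBINT t. \<bar>f t\<bar> / (1 + \<bar>t\<bar>) ^ p)"
      by (rule convolution_weight(2)[OF f fp])
    also have "\<dots> \<le> (1 + \<bar>R\<bar>) ^ p * (LBINT t. \<bar>f t\<bar> / (1 + \<bar>t\<bar>) ^ p)"
      using x by (intro mult_right_mono power_mono Bochner_Integration.integral_nonneg) auto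
    finally have "e * I + D / real n * ((LBINT y. \<bar>f (x - y)\<bar> * (1 / (1 + \<bar>y\<bar>) ^ p)) + B * W)
        \<le> e * I + D / real n * K"
      unfolding K_def using D by (intro add_left_mono mult_left_mono add_right_mono) auto
    with 1 show ?thesis
      by (rule order_trans)
  qed
  have "(\<lambda>n. D / real n * K) \<longlonglongrightarrow> 0"
    by (auto intro!: tendsto_eq_intros tendsto_divide_0[OF tendsto_const] filterlim_at_top_imp_at_infinity
        filterlim_real_sequentially)
  then have "\<forall>\<^sub>F n in sequentially. D / real n * K < \<epsilon> / 2"
    using \<epsilon> by (intro order_tendstoD) auto
  moreover have "\<forall>\<^sub>F n in sequentially. n \<ge> 1"
    by (rule eventually_ge_at_top)
  ultimately show "\<forall>\<^sub>F n in sequentially. \<forall>x\<in>{-R..R}. dist (convolution f (rescale \<Phi> n) x) (f x) < \<epsilon>"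
  proof eventually_elim
    case (elim n)
    have "e * I \<le> \<epsilon> / 2"
      using I \<epsilon> by (simp add: e_def field_simps)
    then have "\<bar>convolution f (rescale \<Phi> n) x - f x\<bar> < \<epsilon>" if "x \<in> {-R..R}" for x
      using main[OF that, of n] elim by linarith
    then show ?case
      by (simp add: dist_real_def)
  qed
qed

lemma convolvable_moderate_growth:
  assumes f: "continuous_on UNIV f"
    and conv: "\<And>\<Phi> n. mollifier \<Phi> \<Longrightarrow> n \<ge> 1 \<Longrightarrow> convolvable f (rescale \<Phi> n)"
  obtains p where "p \<ge> 2" "integrable lborel (\<lambda>t. \<bar>f t\<bar> / (1 + \<bar>t\<bar>) ^ p)"
proof -
  have "integrable lborel (\<lambda>y. f (- y) * \<Phi> y)" if "mollifier \<Phi>" for \<Phi>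
  proof -
    have "integrable lborel (\<lambda>y. f (0 - y) * rescale \<Phi> 1 y)"
      using conv[OF that order_refl] unfolding convolvable_def by (rule spec)
    then show ?thesis
      by (simp add: rescale_def)
  qed
  with f show ?thesis
    by (rule moderate_growth) (assumption | rule that)+
qed

text \<open>The index 0 is included, where the rescaled mollifier is the zero function and so is the
  convolution. Continuity of the mollified coefficients then carries no side condition on
  \<open>n\<close>.\<close>

lemma convolution_rescale_continuous:
  assumes f: "continuous_on UNIV f"
    and conv: "\<And>\<Phi> n. mollifier \<Phi> \<Longrightarrow> n \<ge> 1 \<Longrightarrow> convolvable f (rescale \<Phi> n)"
    and \<Phi>: "mollifier \<Phi>"
  shows "continuous_on UNIV (convolution f (rescale \<Phi> n))"
    and "continuous_on UNIV (deriv (convolution f (rescale \<Phi> n)))"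
proof -
  have "continuous_on UNIV (convolution f (rescale \<Phi> n)) \<and>
      continuous_on UNIV (deriv (convolution f (rescale \<Phi> n)))"
  proof (cases "n = 0")
    case True
    then have *: "convolution f (rescale \<Phi> n) = (\<lambda>x. 0)"
      by (simp add: convolution_def[abs_def] rescale_def)
    then have "deriv (convolution f (rescale \<Phi> n)) = (\<lambda>x. 0)"
      by simp
    with * show ?thesis by simp
  next
    case False
    obtain p where p: "integrable lborel (\<lambda>t. \<bar>f t\<bar> / (1 + \<bar>t\<bar>) ^ p)"
      using convolvable_moderate_growth[OF f conv] by blast
    have S: "schwartz (rescale \<Phi> n)"
      using rescale_mollifier(1)[OF \<Phi>] False by simp
    let ?c = "\<lambda>k. convolution f ((deriv ^^ k) (rescale \<Phi> n))"
    have d: "(?c k has_real_derivative ?c (Suc k) x) (at x)" for k x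
      by (rule convolution_has_derivative[OF f p S])
    have "continuous_on UNIV (?c k)" for k
      using d DERIV_isCont continuous_at_imp_continuous_on by blast
    moreover have "deriv (?c 0) = ?c (Suc 0)"
      by (rule ext) (rule DERIV_imp_deriv[OF d])
    ultimately have "continuous_on UNIV (?c 0) \<and> continuous_on UNIV (deriv (?c 0))"
      by (simp only:)
    then show ?thesis
      by simp
  qed
  then show "continuous_on UNIV (convolution f (rescale \<Phi> n))"
    "continuous_on UNIV (deriv (convolution f (rescale \<Phi> n)))"
    by auto
qed

section \<open>Global solutions of Lipschitz differential equations\<close>

definition primitive :: "(real \<Rightarrow> 'a::euclidean_space) \<Rightarrow> real \<Rightarrow> 'a" where
  "primitive g x = (LBINT y=0..ereal x. g y)"

lemma primitive_0 [simp]: "primitive g 0 = 0"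
  by (simp add: primitive_def zero_ereal_def)

lemma primitive_has_vector_derivative:
  assumes "continuous_on UNIV g"
  shows "(primitive g has_vector_derivative g x) (at x within S)"
proof -
  define R where "R = \<bar>x\<bar> + 1"
  have "((\<lambda>u. LBINT y=ereal 0..ereal u. g y) has_vector_derivative g x) (at x within {-R..R})"
    by (rule interval_integral_FTC2) (use continuous_on_subset[OF assms] in \<open>auto simp: R_def\<close>)
  moreover have "at x within {-R..R} = at x"
    by (rule at_within_interior) (auto simp: R_def interior_cbox[of "-R" R, simplified])
  ultimately have "(primitive g has_vector_derivative g x) (at x)"
    by (simp add: primitive_def[abs_def] zero_ereal_def)
  then show ?thesis
    by (rule has_vector_derivative_at_within)
qed

lemma primitive_has_real_derivative:
  fixes g :: "real \<Rightarrow> real"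
  assumes "continuous_on UNIV g"
  shows "(primitive g has_real_derivative g x) (at x within S)"
  using primitive_has_vector_derivative[OF assms]
  by (simp add: has_real_derivative_iff_has_vector_derivative)

lemma primitive_continuous:
  assumes "continuous_on UNIV g"
  shows "continuous_on S (primitive g)"
  using primitive_has_vector_derivative[OF assms]
  by (meson continuous_on_eq_continuous_within has_vector_derivative_continuous)

text \<open>Makes the Picard operator a contraction for the weighted norm \<open>sup \<parallel>X t\<parallel> exp (- a \<bar>t\<bar>)\<close>.\<close>

lemma norm_le_exp_of_derivative_le:
  fixes D :: "real \<Rightarrow> 'a::real_normed_vector"
  assumes a: "a > 0" and D0: "D 0 = 0"
    and D: "\<And>t. \<bar>t\<bar> \<le> R \<Longrightarrow> (D has_vector_derivative D' t) (at t within {-R..R})"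
    and le: "\<And>t. \<bar>t\<bar> \<le> R \<Longrightarrow> norm (D' t) \<le> C * exp (a * \<bar>t\<bar>)"
    and x: "\<bar>x\<bar> \<le> R"
  shows "norm (D x) \<le> C / a * exp (a * \<bar>x\<bar>)"
proof -
  \<comment> \<open>Stated for arbitrary \<open>E\<close>, so that it also applies to the reflected
    function D(- t) when x < 0. The comparison function C/a exp(a t) is a primitive of the bound C
    exp(a t).\<close>
  have *: "norm (E y) \<le> C / a * exp (a * y)"
    if E0: "E 0 = 0" and y: "0 \<le> y" "y \<le> R"
      and E: "\<And>t. \<bar>t\<bar> \<le> R \<Longrightarrow> (E has_vector_derivative E' t) (at t within {-R..R})"
      and El: "\<And>t. \<bar>t\<bar> \<le> R \<Longrightarrow> norm (E' t) \<le> C * exp (a * \<bar>t\<bar>)"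
    for E E' :: "real \<Rightarrow> 'a" and y
  proof (cases "y = 0")
    case True
    have "0 \<le> C"
      using order_trans[OF norm_ge_zero El[of 0]] y by simp
    then show ?thesis
      using True E0 a by simp
  next
    case False
    have sub: "{0..y} \<subseteq> {-R..R}"
      using y by auto
    have "norm (E y - E 0) \<le> C / a * exp (a * y) - C / a * exp (a * 0)"
    proof (rule differentiable_bound_general[where f'=E' and \<phi>'="\<lambda>t. C * exp (a * t)"])
      show "0 < y" using False y by simp
      have "continuous (at t within {0..y}) E" if "t \<in> {0..y}" for t
        using E[of t] that y sub
        by (meson abs_le_iff atLeastAtMost_iff continuous_within_subset has_vector_derivative_continuous minus_le_iff order_trans subset_iff)
      then show "continuous_on {0..y} E"
        by (simp add: continuous_on_eq_continuous_within)
      show "continuous_on {0..y} (\<lambda>t. C / a * exp (a * t))"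
        by (intro continuous_intros)
      fix t assume t: "0 < t" "t < y"
      have "at t within {-R..R} = at t"
        by (rule at_within_interior) (use t y in \<open>auto simp: interior_cbox[of "-R" R, simplified]\<close>)
      then show "(E has_vector_derivative E' t) (at t)"
        using E[of t] t y by simp
      show "((\<lambda>t. C / a * exp (a * t)) has_vector_derivative C * exp (a * t)) (at t)"
        unfolding has_real_derivative_iff_has_vector_derivative[symmetric]
        using a by (auto intro!: derivative_eq_intros)
      show "norm (E' t) \<le> C * exp (a * t)"
        using El[of t] t y by simp
    qed
    moreover have "0 \<le> C"
      using order_trans[OF norm_ge_zero El[of 0]] y by simp
    then have "0 \<le> C / a * exp (a * 0)"
      using a by simp
    ultimately show ?thesis
      using E0 by simp
  qed
  show ?thesis
  proof (cases "x \<ge> 0")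
    case True
    then show ?thesis
      using *[of D x D'] D0 D le x by simp
  next
    case False
    have "norm ((\<lambda>t. D (- t)) (- x)) \<le> C / a * exp (a * (- x))"
    proof (rule *[where E'="\<lambda>t. - D' (- t)"])
      fix t :: real assume t: "\<bar>t\<bar> \<le> R"
      have im: "uminus ` {-R..R} = {-R..R}"
        by simp
      have "(D has_vector_derivative D' (- t)) (at (- t) within uminus ` {-R..R})"
        unfolding im using D[of "- t"] t by simp
      moreover have "(uminus has_vector_derivative - 1) (at t within {-R..R})"
        by (auto intro!: derivative_eq_intros)
      ultimately have "(D \<circ> uminus has_vector_derivative (- 1) *\<^sub>R D' (- t)) (at t within {-R..R})"
        by (intro vector_diff_chain_within)
      then show "((\<lambda>t. D (- t)) has_vector_derivative - D' (- t)) (at t within {-R..R})"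
        by (simp add: o_def)
      show "norm (- D' (- t)) \<le> C * exp (a * \<bar>t\<bar>)"
        using le[of "- t"] t by simp
    qed (use D0 False x in auto)
    then show ?thesis using False by simp
  qed
qed

lemma linear_growth_of_derivative_le:
  fixes D :: "real \<Rightarrow> 'a::real_normed_vector"
  assumes D0: "D 0 = 0" and D: "\<And>t. (D has_vector_derivative D' t) (at t)"
    and le: "\<And>t. \<bar>t\<bar> \<le> R \<Longrightarrow> norm (D' t) \<le> C" and x: "\<bar>x\<bar> \<le> R"
  shows "norm (D x) \<le> C * R"
proof -
  have C: "C \<ge> 0"
    using order_trans[OF norm_ge_zero le[of 0]] x by simp
  have "norm (D x - D 0) \<le> C * norm (x - 0)"
  proof (rule differentiable_bound[where f'="\<lambda>t h. h *\<^sub>R D' t" and S="{-R..R}"])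
    show "(D has_derivative (\<lambda>h. h *\<^sub>R D' t)) (at t within {-R..R})" for t
      using has_vector_derivative_at_within[OF D[of t]] by (simp add: has_vector_derivative_def)
    show "onorm (\<lambda>h. h *\<^sub>R D' t) \<le> C" if "t \<in> {-R..R}" for t
      using le[of t] that C
      by (intro onorm_le) (auto simp: mult.commute[of C] intro!: mult_left_mono)
  qed (use x in auto)
  also have "\<dots> \<le> C * R"
    using C x by (intro mult_left_mono) auto
  finally show ?thesis
    using D0 by simp
qed

text \<open>Continuity is required along continuous curves, which is the form Picard iteration
  consumes. The Lipschitz bound is local in time but global in space, so solutions cannot escape and
  exist on the whole line.\<close>

locale lipschitz_ode =
  fixes G :: "real \<Rightarrow> 'a::euclidean_space \<Rightarrow> 'a"
  assumes cont: "\<And>X. continuous_on UNIV X \<Longrightarrow> continuous_on UNIV (\<lambda>t. G t (X t))"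
    and lip: "\<And>R. \<exists>L. \<forall>t X Y. \<bar>t\<bar> \<le> R \<longrightarrow> norm (G t X - G t Y) \<le> L * norm (X - Y)"
begin

lemma lip_pos:
  obtains L where "L > 0" "\<And>t X Y. \<bar>t\<bar> \<le> R \<Longrightarrow> norm (G t X - G t Y) \<le> L * norm (X - Y)"
proof -
  obtain L where L: "\<And>t X Y. \<bar>t\<bar> \<le> R \<Longrightarrow> norm (G t X - G t Y) \<le> L * norm (X - Y)"
    using lip by blast
  have "norm (G t X - G t Y) \<le> max L 1 * norm (X - Y)" if "\<bar>t\<bar> \<le> R" for t X Y
    by (rule order_trans[OF L[OF that]]) (auto intro: mult_right_mono)
  then show ?thesis
    by (intro that[of "max L 1"]) auto
qed

lemma continuous_exp_bound:
  fixes D :: "real \<Rightarrow> 'a"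
  assumes "continuous_on UNIV D" and "a > 0"
  obtains M where "\<And>t. \<bar>t\<bar> \<le> R \<Longrightarrow> norm (D t) \<le> M * exp (a * \<bar>t\<bar>)"
proof -
  have "bounded (D ` {-R..R})"
    by (intro compact_imp_bounded compact_continuous_image continuous_on_subset[OF assms(1)]) auto
  then obtain M where M: "M > 0" "\<And>t. t \<in> {-R..R} \<Longrightarrow> norm (D t) \<le> M"
    unfolding bounded_pos by auto
  have "norm (D t) \<le> M * exp (a * \<bar>t\<bar>)" if "\<bar>t\<bar> \<le> R" for t
  proof -
    have "M * 1 \<le> M * exp (a * \<bar>t\<bar>)"
      using M(1) assms(2) by (intro mult_left_mono) auto
    moreover have "t \<in> {-R..R}"
      using that by auto
    ultimately show ?thesis
      using M(2)[of t] by linarith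
  qed
  then show ?thesis by (rule that)
qed

text \<open>With the rate 2L one integration multiplies the weighted bound by L/(2L) = 1/2;
  iterating drives the bound on the difference of two solutions to 0.\<close>

lemma unique:
  assumes X: "\<And>t. (X has_vector_derivative G t (X t)) (at t)"
    and Y: "\<And>t. (Y has_vector_derivative G t (Y t)) (at t)"
    and 0: "X 0 = Y 0"
  shows "X = Y"
proof
  fix x :: real
  define R where "R = \<bar>x\<bar>"
  obtain L where L: "L > 0" "\<And>t X Y. \<bar>t\<bar> \<le> R \<Longrightarrow> norm (G t X - G t Y) \<le> L * norm (X - Y)"
    using lip_pos[of R] by blast
  have "continuous_on UNIV (\<lambda>t. X t - Y t)"
    using X Y by (intro continuous_on_diff)
      (meson continuous_at_imp_continuous_on has_vector_derivative_continuous)+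
  then obtain M where M: "\<And>t. \<bar>t\<bar> \<le> R \<Longrightarrow> norm (X t - Y t) \<le> M * exp (2 * L * \<bar>t\<bar>)"
    using continuous_exp_bound[of "\<lambda>t. X t - Y t" "2 * L" R] L(1) by auto
  have "norm (X t - Y t) \<le> M / 2 ^ k * exp (2 * L * \<bar>t\<bar>)" if "\<bar>t\<bar> \<le> R" for t k
    using that
  proof (induction k arbitrary: t)
    case 0
    then show ?case using M by simp
  next
    case (Suc k)
    have "norm (X t - Y t) \<le> L * (M / 2 ^ k) / (2 * L) * exp (2 * L * \<bar>t\<bar>)"
    proof (rule norm_le_exp_of_derivative_le[where D'="\<lambda>t. G t (X t) - G t (Y t)" and R=R])
      show "((\<lambda>t. X t - Y t) has_vector_derivative G s (X s) - G s (Y s)) (at s within {-R..R})" for s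
        by (rule has_vector_derivative_at_within, rule has_vector_derivative_diff, rule X, rule Y)
      fix s assume s: "\<bar>s\<bar> \<le> R"
      have "norm (G s (X s) - G s (Y s)) \<le> L * (M / 2 ^ k * exp (2 * L * \<bar>s\<bar>))"
        using L(1) by (intro order_trans[OF L(2)[OF s]] mult_left_mono Suc.IH[OF s]) auto
      then show "norm (G s (X s) - G s (Y s)) \<le> L * (M / 2 ^ k) * exp (2 * L * \<bar>s\<bar>)"
        by (simp add: mult.assoc)
    qed (use Suc.prems L(1) 0 in auto)
    then show ?case
      using L(1) by simp
  qed
  then have "norm (X x - Y x) \<le> (M * exp (2 * L * \<bar>x\<bar>)) * (1 / 2) ^ k" for k
    by (simp add: R_def power_divide)
  moreover have "(\<lambda>k. (M * exp (2 * L * \<bar>x\<bar>)) * (1 / 2) ^ k) \<longlonglongrightarrow> (M * exp (2 * L * \<bar>x\<bar>)) * 0"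
    by (intro tendsto_intros LIMSEQ_power_zero) simp
  ultimately have "norm (X x - Y x) \<le> 0"
    by (metis LIMSEQ_le_const mult_zero_right)
  then show "X x = Y x" by simp
qed

section \<open>Picard iteration\<close>

context
  fixes x0 :: 'a
begin

fun picard :: "nat \<Rightarrow> real \<Rightarrow> 'a" where
  "picard 0 = (\<lambda>t. x0)"
| "picard (Suc k) = (\<lambda>t. x0 + primitive (\<lambda>s. G s (picard k s)) t)"

declare picard.simps(2) [simp del]

lemma picard_continuous: "continuous_on UNIV (picard k)"
  by (induction k) (auto simp: picard.simps(2) intro!: continuous_intros primitive_continuous cont)

text \<open>The same halving as for uniqueness, with rate a = 2L, now applied to successive
  iterates. Both constants depend on \<open>R\<close>, since \<open>L\<close> does.\<close>

lemma picard_cauchy: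
  obtains a M where "a > 0"
    "\<And>k t. \<bar>t\<bar> \<le> R \<Longrightarrow> norm (picard (Suc k) t - picard k t) \<le> M / 2 ^ k * exp (a * \<bar>t\<bar>)"
proof -
  obtain L where L: "L > 0" "\<And>t X Y. \<bar>t\<bar> \<le> R \<Longrightarrow> norm (G t X - G t Y) \<le> L * norm (X - Y)"
    using lip_pos[of R] by blast
  obtain M where M: "\<And>t. \<bar>t\<bar> \<le> R \<Longrightarrow> norm (picard (Suc 0) t - picard 0 t) \<le> M * exp (2 * L * \<bar>t\<bar>)"
    using continuous_exp_bound[OF continuous_on_diff[OF picard_continuous[of "Suc 0"] picard_continuous[of 0]], of "2 * L" R]
      L(1) by auto
  have "norm (picard (Suc k) t - picard k t) \<le> M / 2 ^ k * exp (2 * L * \<bar>t\<bar>)" if "\<bar>t\<bar> \<le> R" for t k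
    using that
  proof (induction k arbitrary: t)
    case 0
    then show ?case using M by simp
  next
    case (Suc k)
    have "norm (picard (Suc (Suc k)) t - picard (Suc k) t) \<le> L * (M / 2 ^ k) / (2 * L) * exp (2 * L * \<bar>t\<bar>)"
    proof (rule norm_le_exp_of_derivative_le[where
          D'="\<lambda>s. G s (picard (Suc k) s) - G s (picard k s)" and R=R])
      have "((\<lambda>t. primitive (\<lambda>s. G s (picard (Suc k) s)) t - primitive (\<lambda>s. G s (picard k s)) t)
          has_vector_derivative G s (picard (Suc k) s) - G s (picard k s)) (at s within {-R..R})" for s
        by (intro has_vector_derivative_diff primitive_has_vector_derivative cont picard_continuous)
      then show "((\<lambda>t. picard (Suc (Suc k)) t - picard (Suc k) t)
          has_vector_derivative G s (picard (Suc k) s) - G s (picard k s)) (at s within {-R..R})" for s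
        by (simp only: picard.simps add_diff_cancel_left)
      fix s assume s: "\<bar>s\<bar> \<le> R"
      have "norm (G s (picard (Suc k) s) - G s (picard k s)) \<le> L * (M / 2 ^ k * exp (2 * L * \<bar>s\<bar>))"
        using L(1) by (intro order_trans[OF L(2)[OF s]] mult_left_mono Suc.IH[OF s]) auto
      then show "norm (G s (picard (Suc k) s) - G s (picard k s)) \<le> L * (M / 2 ^ k) * exp (2 * L * \<bar>s\<bar>)"
        by (simp only: mult.assoc)
    qed (use Suc.prems L(1) in \<open>auto simp: picard.simps(2)\<close>)
    then show ?case
      using L(1) by simp
  qed
  moreover have "2 * L > 0"
    using L(1) by simp
  ultimately show ?thesis
    by (rule that[rotated])
qed

text \<open>The iterates are telescoping sums with a geometric majorant. Writing the limit as the
  pointwise \<open>lim\<close> gives the same function for every \<open>R\<close>, so the local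
  limits need no gluing.\<close>

lemma picard_uniform_limit:
  "uniform_limit {-R..R} picard (\<lambda>t. lim (\<lambda>k. picard k t)) sequentially"
proof -
  obtain a M where M: "a > 0"
    "\<And>k t. \<bar>t\<bar> \<le> R \<Longrightarrow> norm (picard (Suc k) t - picard k t) \<le> M / 2 ^ k * exp (a * \<bar>t\<bar>)"
    using picard_cauchy[of R] by (metis (no_types, lifting))
  have "uniformly_convergent_on {-R..R} (\<lambda>n t. \<Sum>k<n. picard (Suc k) t - picard k t)"
  proof (rule Weierstrass_m_test')
    show "summable (\<lambda>k. \<bar>M\<bar> * exp (a * \<bar>R\<bar>) * (1 / 2) ^ k)"
      by (intro summable_mult summable_geometric) simp
    fix k and t :: real assume t: "t \<in> {-R..R}"
    have "norm (picard (Suc k) t - picard k t) \<le> M / 2 ^ k * exp (a * \<bar>t\<bar>)"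
      using M(2)[of t k] t by auto
    also have "\<dots> \<le> \<bar>M\<bar> / 2 ^ k * exp (a * \<bar>R\<bar>)"
      using t M(1) by (intro mult_mono divide_right_mono) auto
    finally show "norm (picard (Suc k) t - picard k t) \<le> \<bar>M\<bar> * exp (a * \<bar>R\<bar>) * (1 / 2) ^ k"
      by (simp add: power_divide)
  qed
  moreover have "(\<Sum>k<n. picard (Suc k) t - picard k t) = picard n t - x0" for n t
    by (subst sum_lessThan_telescope) simp
  ultimately have "uniformly_convergent_on {-R..R} (\<lambda>n t. picard n t - x0)"
    by simp
  then obtain l where "uniform_limit {-R..R} (\<lambda>n t. picard n t - x0) l sequentially"
    unfolding uniformly_convergent_on_def by blast
  from uniform_limit_add[OF this uniform_limit_const[where c="\<lambda>_. x0"]]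
  have "uniformly_convergent_on {-R..R} picard"
    unfolding uniformly_convergent_on_def by auto
  then show ?thesis
    by (simp add: uniformly_convergent_uniform_limit_iff)
qed

lemma exists_solution:
  "\<exists>X. X 0 = x0 \<and> (\<forall>t. (X has_vector_derivative G t (X t)) (at t))"
proof -
  define X where "X t = lim (\<lambda>k. picard k t)" for t
  have ul: "uniform_limit {-R..R} picard X sequentially" for R
    using picard_uniform_limit[of R] by (simp add: X_def[abs_def])
  have cX: "continuous_on {-R..R} X" for R
    by (rule uniform_limit_theorem[OF _ ul])
      (auto intro: always_eventually continuous_on_subset[OF picard_continuous])
  have "continuous_on {-(\<bar>t\<bar>+1)<..<\<bar>t\<bar>+1} X" for t
    by (rule continuous_on_subset[OF cX[of "\<bar>t\<bar>+1"]]) auto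
  then have "isCont X t" for t
    by (rule continuous_on_interior[of "{-(\<bar>t\<bar>+1)<..<\<bar>t\<bar>+1}"]) auto
  then have X: "continuous_on UNIV X"
    by (simp add: continuous_at_imp_continuous_on)
  \<comment> \<open>\<open>Y\<close> is the image of \<open>X\<close> under the Picard operator.
    Showing X = Y gives the fixed point, and \<open>Y\<close> is visibly differentiable.\<close>
  define Y where "Y t = x0 + primitive (\<lambda>s. G s (X s)) t" for t
  have "X x = Y x" for x
  proof -
    define R where "R = \<bar>x\<bar> + 1"
    have R: "R > 0" by (simp add: R_def)
    obtain L where L: "L > 0" "\<And>t X Y. \<bar>t\<bar> \<le> R \<Longrightarrow> norm (G t X - G t Y) \<le> L * norm (X - Y)"
      using lip_pos[of R] by blast
    have "(\<lambda>k. picard (Suc k) x) \<longlonglongrightarrow> Y x"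
    proof (rule tendstoI)
      fix e :: real assume e: "e > 0"
      have "\<forall>\<^sub>F k in sequentially. \<forall>t\<in>{-R..R}. dist (picard k t) (X t) < e / (2 * L * R)"
        using e L(1) by (intro uniform_limitD[OF ul]) (auto simp: R_def)
      then show "\<forall>\<^sub>F k in sequentially. dist (picard (Suc k) x) (Y x) < e"
      proof eventually_elim
        case (elim k)
        let ?D = "\<lambda>t. primitive (\<lambda>s. G s (picard k s)) t - primitive (\<lambda>s. G s (X s)) t"
        \<comment> \<open>The tolerance e/(2LR) is multiplied by \<open>L\<close> through the
          Lipschitz bound and by \<open>R\<close> through integration, which leaves e/2.\<close>
        have "norm (?D x) \<le> L * (e / (2 * L * R)) * R"
        proof (rule linear_growth_of_derivative_le[where D'="\<lambda>s. G s (picard k s) - G s (X s)"])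
          show "(?D has_vector_derivative G t (picard k t) - G t (X t)) (at t)" for t
            by (intro has_vector_derivative_diff primitive_has_vector_derivative cont X picard_continuous)
          fix t assume t: "\<bar>t\<bar> \<le> R"
          then have "norm (picard k t - X t) \<le> e / (2 * L * R)"
            using elim[rule_format, of t] by (auto simp: dist_norm abs_le_iff intro: less_imp_le)
          then show "norm (G t (picard k t) - G t (X t)) \<le> L * (e / (2 * L * R))"
            using L(1) by (intro order_trans[OF L(2)[OF t]] mult_left_mono) auto
        qed (auto simp: R_def)
        also have "\<dots> = e / 2"
          using L(1) R by simp
        finally show ?case
          using e by (simp add: Y_def dist_norm picard.simps(2))
      qed
    qed
    moreover have "(\<lambda>k. picard (Suc k) x) \<longlonglongrightarrow> X x"
      by (rule LIMSEQ_Suc, rule tendsto_uniform_limitI[OF ul[of R]]) (auto simp: R_def)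
    ultimately show ?thesis
      by (rule LIMSEQ_unique[rotated])
  qed
  then have XY: "X = Y" by auto
  have "(Y has_vector_derivative G t (X t)) (at t)" for t
    unfolding Y_def[abs_def]
    by (rule has_vector_derivative_eq_rhs, rule has_vector_derivative_add)
      (auto intro: has_vector_derivative_const primitive_has_vector_derivative cont X)
  moreover have "Y 0 = x0" by (simp add: Y_def)
  ultimately show ?thesis using XY by auto
qed

end

end

section \<open>Locally uniform convergence\<close>

text \<open>Continuous convergence; for continuous limits it is locally uniform convergence, but it is
  closed under algebraic operations by the usual limit rules.\<close>

definition cconv :: "(nat \<Rightarrow> real \<Rightarrow> real) \<Rightarrow> (real \<Rightarrow> real) \<Rightarrow> bool" where
  "cconv f g \<longleftrightarrow> (\<forall>x. ((\<lambda>p. f (fst p) (snd p)) \<longlongrightarrow> g x) (sequentially \<times>\<^sub>F nhds x))"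

text \<open>Each point has a neighbourhood on which one threshold for n works; a finite subcover
  yields a common threshold on \<open>K\<close>.\<close>

lemma eventually_on_compact:
  fixes K :: "real set"
  assumes K: "compact K"
    and ev: "\<And>x. x \<in> K \<Longrightarrow> \<forall>\<^sub>F p in sequentially \<times>\<^sub>F nhds x. P (fst p) (snd p)"
  shows "\<forall>\<^sub>F n in sequentially. \<forall>y\<in>K. P n y"
proof -
  have "\<exists>U. open U \<and> x \<in> U \<and> (\<forall>\<^sub>F n in sequentially. \<forall>y\<in>U. P n y)" if x: "x \<in> K" for x
  proof -
    obtain A B where AB: "eventually A sequentially" "eventually B (nhds x)"
      "\<And>n y. A n \<Longrightarrow> B y \<Longrightarrow> P n y"
      using ev[OF x] unfolding eventually_prod_filter by auto
    obtain U where "open U" "x \<in> U" "\<And>y. y \<in> U \<Longrightarrow> B y"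
      using AB(2) unfolding eventually_nhds by blast
    then show ?thesis
      using AB by (intro exI[of _ U]) (auto elim: eventually_mono)
  qed
  then obtain U where U: "\<And>x. x \<in> K \<Longrightarrow> open (U x) \<and> x \<in> U x \<and> (\<forall>\<^sub>F n in sequentially. \<forall>y\<in>U x. P n y)"
    by metis
  obtain C where C: "C \<subseteq> K" "finite C" "K \<subseteq> (\<Union>x\<in>C. U x)"
    by (rule compactE_image[OF K, of K U]) (use U in auto)
  have "\<forall>\<^sub>F n in sequentially. \<forall>x\<in>C. \<forall>y\<in>U x. P n y"
    using C U by (intro eventually_ball_finite) auto
  then show ?thesis
    by eventually_elim (use C(3) in blast)
qed

lemma cconvI_uniform:
  assumes g: "continuous_on UNIV g" and f: "\<And>R. uniform_limit {-R..R} f g sequentially"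
  shows "cconv f g"
  unfolding cconv_def
proof (intro allI tendstoI)
  fix x e :: real assume e: "e > 0"
  define R where "R = \<bar>x\<bar> + 1"
  have 1: "\<forall>\<^sub>F n in sequentially. \<forall>y\<in>{-R..R}. dist (f n y) (g y) < e / 2"
    using f[of R] e by (intro uniform_limitD) auto
  have "isCont g x"
    using g by (simp add: continuous_on_eq_continuous_at)
  then have "(g \<longlongrightarrow> g x) (nhds x)"
    by (simp add: isCont_def tendsto_at_iff_tendsto_nhds)
  then have 2: "\<forall>\<^sub>F y in nhds x. dist (g y) (g x) < e / 2"
    using e by (intro tendstoD) auto
  have 3: "\<forall>\<^sub>F y in nhds x. y \<in> {-R<..<R}"
    by (intro eventually_nhds_in_open) (auto simp: R_def)
  show "\<forall>\<^sub>F p in sequentially \<times>\<^sub>F nhds x. dist (f (fst p) (snd p)) (g x) < e"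
    unfolding eventually_prod_filter
  proof (intro exI conjI allI impI)
    show "\<forall>\<^sub>F y in nhds x. dist (g y) (g x) < e / 2 \<and> y \<in> {-R<..<R}"
      using 2 3 by (rule eventually_conj)
    fix n y
    assume n: "\<forall>y\<in>{-R..R}. dist (f n y) (g y) < e / 2" and y: "dist (g y) (g x) < e / 2 \<and> y \<in> {-R<..<R}"
    then have "dist (f n y) (g y) < e / 2"
      by auto
    then show "dist (f (fst (n, y)) (snd (n, y))) (g x) < e"
      using y dist_triangle[of "f n y" "g x" "g y"] by simp
  qed (rule 1)
qed

lemma cconv_fixed:
  assumes "continuous_on UNIV g"
  shows "cconv (\<lambda>n. g) g"
  using assms by (rule cconvI_uniform) (simp add: uniform_limit_const)

lemma cconv_arith:
  assumes "cconv f g" "cconv f' g'"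
  shows cconv_add: "cconv (\<lambda>n y. f n y + f' n y) (\<lambda>y. g y + g' y)"
    and cconv_diff: "cconv (\<lambda>n y. f n y - f' n y) (\<lambda>y. g y - g' y)"
    and cconv_mult: "cconv (\<lambda>n y. f n y * f' n y) (\<lambda>y. g y * g' y)"
    and cconv_divide: "(\<And>y. g' y \<noteq> 0) \<Longrightarrow> cconv (\<lambda>n y. f n y / f' n y) (\<lambda>y. g y / g' y)"
    and cconv_max: "cconv (\<lambda>n y. max (f n y) (f' n y)) (\<lambda>y. max (g y) (g' y))"
  using assms unfolding cconv_def
  by (auto intro: tendsto_add tendsto_diff tendsto_mult tendsto_divide tendsto_max)

lemma cconv_exp: "cconv f g \<Longrightarrow> cconv (\<lambda>n y. exp (f n y)) (\<lambda>y. exp (g y))"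
  unfolding cconv_def by (auto intro: tendsto_exp)

lemma cconv_minus: "cconv f g \<Longrightarrow> cconv (\<lambda>n y. - f n y) (\<lambda>y. - g y)"
  unfolding cconv_def by (auto intro: tendsto_minus)

lemma cconv_uniform_limit:
  assumes g: "continuous_on UNIV g" and fg: "cconv f g" and K: "compact K"
  shows "uniform_limit K f g sequentially"
proof (rule uniform_limitI)
  fix e :: real assume e: "e > 0"
  have "cconv (\<lambda>n y. f n y - g y) (\<lambda>y. g y - g y)"
    using fg cconv_fixed[OF g] by (rule cconv_diff)
  then have "((\<lambda>p. f (fst p) (snd p) - g (snd p)) \<longlongrightarrow> 0) (sequentially \<times>\<^sub>F nhds x)" for x
    by (simp add: cconv_def)
  then have "\<forall>\<^sub>F p in sequentially \<times>\<^sub>F nhds x. dist (f (fst p) (snd p)) (g (snd p)) < e" for x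
    using tendstoD[OF _ e] by (fastforce simp: dist_norm)
  then show "\<forall>\<^sub>F n in sequentially. \<forall>y\<in>K. dist (f n y) (g y) < e"
    by (intro eventually_on_compact[OF K])
qed

lemma cconv_imp_tendsto:
  assumes "cconv f g"
  shows "(\<lambda>n. f n x) \<longlonglongrightarrow> g x"
proof -
  have "filterlim (\<lambda>n. (n, x)) (sequentially \<times>\<^sub>F nhds x) sequentially"
    by (intro filterlim_Pair filterlim_ident tendsto_const)
  then show ?thesis
    using assms filterlim_compose[of "\<lambda>p. f (fst p) (snd p)" "nhds (g x)"] unfolding cconv_def
    by fastforce
qed

lemma cconv_unique: "cconv f g \<Longrightarrow> cconv f h \<Longrightarrow> g = h"
  using cconv_imp_tendsto LIMSEQ_unique by blast

lemma cconv_cong_eventually: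
  assumes f: "cconv f g" and eq: "\<And>R. \<forall>\<^sub>F n in sequentially. \<forall>y\<in>{-R..R}. f n y = f' n y"
  shows "cconv f' g"
  unfolding cconv_def
proof
  fix x :: real
  define R where "R = \<bar>x\<bar> + 1"
  have "\<forall>\<^sub>F y in nhds x. y \<in> {-R<..<R}"
    by (intro eventually_nhds_in_open) (auto simp: R_def)
  then have "\<forall>\<^sub>F p in sequentially \<times>\<^sub>F nhds x. f (fst p) (snd p) = f' (fst p) (snd p)"
    unfolding eventually_prod_filter using eq[of R] by (intro exI conjI) auto
  then show "((\<lambda>p. f' (fst p) (snd p)) \<longlongrightarrow> g x) (sequentially \<times>\<^sub>F nhds x)"
    using f unfolding cconv_def by (blast intro: Lim_transform_eventually)
qed

lemma cconv_primitive:
  fixes f :: "nat \<Rightarrow> real \<Rightarrow> real"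
  assumes f: "\<forall>\<^sub>F n in sequentially. continuous_on UNIV (f n)" and g: "continuous_on UNIV g"
    and fg: "cconv f g"
  shows "cconv (\<lambda>n. primitive (f n)) (primitive g)"
proof (rule cconvI_uniform[OF primitive_continuous[OF g] uniform_limitI])
  fix R e :: real assume e: "e > 0"
  \<comment> \<open>The divisor \<bar>R\<bar> + 1 is positive for every \<open>R\<close> and exceeds
    it, so that e' * R stays strictly below e.\<close>
  define e' where "e' = e / (\<bar>R\<bar> + 1)"
  have "\<forall>\<^sub>F n in sequentially. \<forall>y\<in>{-R..R}. dist (f n y) (g y) < e'"
    using cconv_uniform_limit[OF g fg, of "{-R..R}"] e
    by (intro uniform_limitD) (auto simp: e'_def)
  then show "\<forall>\<^sub>F n in sequentially. \<forall>x\<in>{-R..R}. dist (primitive (f n) x) (primitive g x) < e"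
    using f
  proof eventually_elim
    case (elim n)
    show ?case
    proof
      fix x assume x: "x \<in> {-R..R}"
      have "norm (primitive (f n) x - primitive g x) \<le> e' * R"
      proof (rule linear_growth_of_derivative_le[where D="\<lambda>x. primitive (f n) x - primitive g x"
            and D'="\<lambda>t. f n t - g t"])
        show "((\<lambda>x. primitive (f n) x - primitive g x) has_vector_derivative f n t - g t) (at t)" for t
          by (intro has_vector_derivative_diff primitive_has_vector_derivative g elim)
        show "norm (f n t - g t) \<le> e'" if "\<bar>t\<bar> \<le> R" for t
        proof -
          have "t \<in> {-R..R}"
            using that by auto
          then have "dist (f n t) (g t) < e'"
            using elim(1) by blast
          then show ?thesis
            by (simp add: dist_norm)
        qed
      qed (use x in auto)
      also have "\<dots> < e"
        using e x by (simp add: e'_def field_simps)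
      finally show "dist (primitive (f n) x) (primitive g x) < e"
        by (simp add: dist_norm)
    qed
  qed
qed

lemma C_k_tendsto_0_iff:
  assumes "continuous_on UNIV g"
  shows "C_k_tendsto 0 f g \<longleftrightarrow> cconv f g"
  using cconv_uniform_limit[OF assms] cconvI_uniform[OF assms] by (auto simp: C_k_tendsto_def)

lemma C_k_tendsto_1_iff:
  assumes "continuous_on UNIV g" "continuous_on UNIV (deriv g)"
  shows "C_k_tendsto 1 f g \<longleftrightarrow> cconv f g \<and> cconv (\<lambda>n. deriv (f n)) (deriv g)"
proof -
  have "(\<forall>j\<le>1. P j) \<longleftrightarrow> P 0 \<and> P (Suc 0)" for P
    by (auto simp: le_Suc_eq)
  then have "C_k_tendsto 1 f g \<longleftrightarrow> C_k_tendsto 0 f g \<and> C_k_tendsto 0 (\<lambda>n. deriv (f n)) (deriv g)"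
    by (simp add: C_k_tendsto_def)
  then show ?thesis
    using assms by (simp add: C_k_tendsto_0_iff)
qed

lemma C_k_0_iff: "C_k 0 f \<longleftrightarrow> continuous_on UNIV f"
  by (simp add: C_k_def)

lemma C_k_1_iff: "C_k 1 f \<longleftrightarrow> (\<forall>x. f differentiable (at x)) \<and> continuous_on UNIV (deriv f)"
  by (auto simp: C_k_def)

lemma C_k_2_iff: "C_k 2 f \<longleftrightarrow> (\<forall>x. f differentiable (at x)) \<and> (\<forall>x. deriv f differentiable (at x)) \<and>
    continuous_on UNIV (deriv (deriv f))"
proof -
  have "(\<forall>j<2. P j) \<longleftrightarrow> P 0 \<and> P (Suc 0)" for P
    by (auto simp: less_Suc_eq numeral_2_eq_2)
  then show ?thesis
    by (simp add: C_k_def numeral_2_eq_2)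
qed

lemma eq_primitive:
  fixes f :: "real \<Rightarrow> real"
  assumes g: "continuous_on UNIV g" and f: "\<And>x. (f has_real_derivative g x) (at x)"
  shows "f x = f 0 + primitive g x"
proof -
  have "norm (f x - f 0 - primitive g x) \<le> 0 * \<bar>x\<bar>"
  proof (rule linear_growth_of_derivative_le[where D="\<lambda>x. f x - f 0 - primitive g x" and D'="\<lambda>_. 0"])
    show "((\<lambda>x. f x - f 0 - primitive g x) has_vector_derivative 0) (at t)" for t
      unfolding has_real_derivative_iff_has_vector_derivative[symmetric]
      by (rule derivative_eq_intros f primitive_has_real_derivative[OF g] refl | simp)+
  qed auto
  then show ?thesis by simp
qed

section \<open>Solutions as limits of mollified problems\<close>

locale mollified_operator =
  fixes \<sigma> \<beta> \<Sigma> :: "real \<Rightarrow> real"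
  assumes \<sigma>: "continuous_on UNIV \<sigma>" and \<beta>: "continuous_on UNIV \<beta>" and \<sigma>_pos: "\<And>x. \<sigma> x > 0"
    and conv_\<sigma>: "\<And>\<Phi> n. mollifier \<Phi> \<Longrightarrow> n \<ge> 1 \<Longrightarrow> convolvable (\<lambda>x. (\<sigma> x)\<^sup>2) (rescale \<Phi> n)"
    and conv_\<beta>: "\<And>\<Phi> n. mollifier \<Phi> \<Longrightarrow> n \<ge> 1 \<Longrightarrow> convolvable \<beta> (rescale \<Phi> n)"
    and \<Sigma>: "continuous_on UNIV \<Sigma>"
    and \<Sigma>_lim: "\<And>\<Phi>. mollifier \<Phi> \<Longrightarrow> C_k_tendsto 0 (Sigma_n \<sigma> \<beta> \<Phi>) \<Sigma>"
begin

lemma \<sigma>2: "continuous_on UNIV (\<lambda>x. (\<sigma> x)\<^sup>2)"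
  by (intro continuous_intros \<sigma>)

lemma \<sigma>_nz [simp]: "\<sigma> x \<noteq> 0"
  using \<sigma>_pos[of x] by simp

context
  fixes \<Phi> assumes \<Phi>: "mollifier \<Phi>"
begin

text \<open>\<open>sigma2_n\<close> may vanish far out; \<open>s n\<close> is positive everywhere and agrees with it on each
  compact set for large \<open>n\<close>.\<close>

definition s :: "nat \<Rightarrow> real \<Rightarrow> real" where
  "s n x = max (sigma2_n \<sigma> \<Phi> n x) ((\<sigma> x)\<^sup>2 / 2)"

definition b' :: "nat \<Rightarrow> real \<Rightarrow> real" where
  "b' n = deriv (beta_n \<beta> \<Phi> n)"

text \<open>The counterpart of \<open>Sigma_n\<close> with the positive denominator
  \<open>s n\<close>: its integrand is continuous on the whole line, so \<open>exp (S n x)\<close>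
  is a global integrating factor.\<close>

definition S :: "nat \<Rightarrow> real \<Rightarrow> real" where
  "S n = primitive (\<lambda>y. 2 * b' n y / s n y)"

lemma b'_continuous: "continuous_on UNIV (b' n)"
  unfolding b'_def beta_n_def by (rule convolution_rescale_continuous[OF \<beta> conv_\<beta> \<Phi>])

lemma sigma2_n_continuous: "continuous_on UNIV (sigma2_n \<sigma> \<Phi> n)"
  unfolding sigma2_n_def by (rule convolution_rescale_continuous[OF \<sigma>2 conv_\<sigma> \<Phi>])

lemma sigma2_n_cconv: "cconv (sigma2_n \<sigma> \<Phi>) (\<lambda>x. (\<sigma> x)\<^sup>2)"
proof -
  obtain p where p: "p \<ge> 2" "integrable lborel (\<lambda>t. \<bar>(\<sigma> t)\<^sup>2\<bar> / (1 + \<bar>t\<bar>) ^ p)"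
    using convolvable_moderate_growth[OF \<sigma>2 conv_\<sigma>] by blast
  show ?thesis
    unfolding sigma2_n_def[abs_def]
    by (rule cconvI_uniform[OF \<sigma>2 convolution_rescale_uniform_limit[OF \<sigma>2 p(2,1) \<Phi>]])
qed

lemma s_pos: "s n x > 0"
  unfolding s_def by (simp add: less_max_iff_disj)

lemma s_nz [simp]: "s n x \<noteq> 0"
  using s_pos[of n x] by simp

lemma s_continuous: "continuous_on UNIV (s n)"
  unfolding s_def[abs_def] by (intro continuous_intros sigma2_n_continuous \<sigma>) simp

lemma s_cconv: "cconv s (\<lambda>x. (\<sigma> x)\<^sup>2)"
proof -
  have "continuous_on UNIV (\<lambda>x. (\<sigma> x)\<^sup>2 / 2)"
    by (intro continuous_intros \<sigma>) simp
  from cconv_max[OF sigma2_n_cconv cconv_fixed[OF this]] show ?thesis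
    by (simp add: s_def[abs_def] max_def)
qed

text \<open>The difference of \<open>sigma2_n\<close> and \<sigma>^2/2 converges locally uniformly
  to \<sigma>^2/2 > 0, so eventually the first argument of the maximum wins.\<close>

lemma s_eq: "\<forall>\<^sub>F n in sequentially. \<forall>y\<in>{-R..R}. s n y = sigma2_n \<sigma> \<Phi> n y"
proof (rule eventually_on_compact)
  fix x :: real
  have "continuous_on UNIV (\<lambda>x. (\<sigma> x)\<^sup>2 / 2)"
    by (intro continuous_intros \<sigma>) simp
  from cconv_diff[OF sigma2_n_cconv cconv_fixed[OF this]]
  have "((\<lambda>p. sigma2_n \<sigma> \<Phi> (fst p) (snd p) - (\<sigma> (snd p))\<^sup>2 / 2) \<longlongrightarrow> (\<sigma> x)\<^sup>2 - (\<sigma> x)\<^sup>2 / 2)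
      (sequentially \<times>\<^sub>F nhds x)"
    by (simp add: cconv_def)
  then have "\<forall>\<^sub>F p in sequentially \<times>\<^sub>F nhds x. sigma2_n \<sigma> \<Phi> (fst p) (snd p) - (\<sigma> (snd p))\<^sup>2 / 2 > 0"
    by (rule order_tendstoD(1)) simp
  then show "\<forall>\<^sub>F p in sequentially \<times>\<^sub>F nhds x. s (fst p) (snd p) = sigma2_n \<sigma> \<Phi> (fst p) (snd p)"
    by eventually_elim (simp add: s_def max_def)
qed simp

lemma S_integrand_continuous: "continuous_on UNIV (\<lambda>y. 2 * b' n y / s n y)"
  by (intro continuous_intros b'_continuous s_continuous) simp

lemma S_derivative: "(S n has_real_derivative 2 * b' n x / s n x) (at x within A)"
  unfolding S_def by (rule primitive_has_real_derivative[OF S_integrand_continuous])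

lemma S_continuous: "continuous_on UNIV (S n)"
  unfolding S_def by (rule primitive_continuous[OF S_integrand_continuous])

lemma S_0 [simp]: "S n 0 = 0"
  by (simp add: S_def)

lemma S_cconv: "cconv S \<Sigma>"
proof (rule cconv_cong_eventually)
  show "cconv (Sigma_n \<sigma> \<beta> \<Phi>) \<Sigma>"
    using \<Sigma>_lim[OF \<Phi>] C_k_tendsto_0_iff[OF \<Sigma>] by blast
  fix R :: real
  show "\<forall>\<^sub>F n in sequentially. \<forall>x\<in>{-R..R}. Sigma_n \<sigma> \<beta> \<Phi> n x = S n x"
    using s_eq[of R]
  proof eventually_elim
    case (elim n)
    show ?case
    proof
      fix x assume x: "x \<in> {-R..R}"
      have "(LBINT y=0..ereal x. 2 * b' n y / s n y) =
          (LBINT y=0..ereal x. 2 * (deriv (beta_n \<beta> \<Phi> n) y / sigma2_n \<sigma> \<Phi> n y))"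
      proof (rule interval_integral_cong)
        fix y assume "y \<in> einterval (min 0 (ereal x)) (max 0 (ereal x))"
        then have "y \<in> {-R..R}"
          using x by (auto simp: einterval_def min_def max_def zero_ereal_def split: if_splits)
        then show "2 * b' n y / s n y = 2 * (deriv (beta_n \<beta> \<Phi> n) y / sigma2_n \<sigma> \<Phi> n y)"
          using elim by (simp add: b'_def)
      qed
      then show "Sigma_n \<sigma> \<beta> \<Phi> n x = S n x"
        by (simp only: Sigma_n_def S_def primitive_def interval_lebesgue_integral_mult_right)
    qed
  qed
qed

text \<open>This normalization identifies the initial value of exp \<Sigma> u' with u'(0).\<close>

lemma \<Sigma>_0: "\<Sigma> 0 = 0"
  using cconv_imp_tendsto[OF S_cconv, of 0] LIMSEQ_unique[OF tendsto_const] by fastforce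

text \<open>Continuity of \<open>ls n\<close> is asked only eventually, because a
  \<open>C1_solution\<close> constrains its approximants from index 1 on.\<close>

lemma source_cconv:
  assumes l: "continuous_on UNIV l" and ls: "\<forall>\<^sub>F n in sequentially. continuous_on UNIV (ls n)"
    and lim: "cconv ls l"
  shows "cconv (\<lambda>n. primitive (\<lambda>y. 2 * exp (S n y) * ls n y / s n y))
    (primitive (\<lambda>y. 2 * exp (\<Sigma> y) * l y / (\<sigma> y)\<^sup>2))"
proof (rule cconv_primitive)
  show "\<forall>\<^sub>F n in sequentially. continuous_on UNIV (\<lambda>y. 2 * exp (S n y) * ls n y / s n y)"
    using ls
  proof eventually_elim
    case (elim n)
    then show ?case
      by (intro continuous_intros S_continuous s_continuous) auto
  qed
  show "continuous_on UNIV (\<lambda>y. 2 * exp (\<Sigma> y) * l y / (\<sigma> y)\<^sup>2)"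
    by (intro continuous_intros \<Sigma> l \<sigma>) simp
  show "cconv (\<lambda>n y. 2 * exp (S n y) * ls n y / s n y) (\<lambda>y. 2 * exp (\<Sigma> y) * l y / (\<sigma> y)\<^sup>2)"
    by (intro cconv_divide cconv_mult cconv_fixed cconv_exp S_cconv s_cconv lim continuous_on_const) simp
qed

text \<open>On [-R, R] and for large n, \<open>s n\<close> equals \<open>sigma2_n\<close>, so the
  mollified equation can be multiplied by 2 exp(S_n)/s_n and integrated from 0. The resulting
  identity contains no second derivative and passes to the limit.\<close>

lemma solution_formula:
  assumes f1: "C_k 1 f" and l: "continuous_on UNIV l"
    and fs: "\<And>n. n \<ge> 1 \<Longrightarrow> C_k 2 (fs n) \<and> C_k 0 (ls n) \<and> (\<forall>x. L_n \<sigma> \<beta> \<Phi> n (fs n) x = ls n x)"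
    and lims: "C_k_tendsto 1 fs f" "C_k_tendsto 0 ls l"
  shows "exp (\<Sigma> x) * deriv f x = deriv f 0 + primitive (\<lambda>y. 2 * exp (\<Sigma> y) * l y / (\<sigma> y)\<^sup>2) x"
proof -
  have f: "continuous_on UNIV f" "continuous_on UNIV (deriv f)"
    using f1 unfolding C_k_1_iff
    by (auto intro!: continuous_at_imp_continuous_on differentiable_imp_continuous_within)
  have f': "cconv (\<lambda>n. deriv (fs n)) (deriv f)"
    using lims(1) C_k_tendsto_1_iff[OF f] by blast
  have l': "cconv ls l"
    using lims(2) C_k_tendsto_0_iff[OF l] by blast
  let ?q = "\<lambda>n y. 2 * exp (S n y) * ls n y / s n y"
  have "\<forall>\<^sub>F n in sequentially. continuous_on UNIV (ls n)"
    using eventually_ge_at_top[of 1] by eventually_elim (use fs in \<open>simp add: C_k_0_iff\<close>)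
  from source_cconv[OF l this l']
  have prim: "cconv (\<lambda>n. primitive (?q n)) (primitive (\<lambda>y. 2 * exp (\<Sigma> y) * l y / (\<sigma> y)\<^sup>2))" .
  have init: "cconv (\<lambda>n y. deriv (fs n) 0) (\<lambda>y. deriv f 0)"
    using cconv_imp_tendsto[OF f', of 0] unfolding cconv_def
    by (auto intro: filterlim_compose[OF _ filterlim_fst])
  have "cconv (\<lambda>n x. exp (S n x) * deriv (fs n) x)
      (\<lambda>x. deriv f 0 + primitive (\<lambda>y. 2 * exp (\<Sigma> y) * l y / (\<sigma> y)\<^sup>2) x)"
  proof (rule cconv_cong_eventually[OF cconv_add[OF init prim]])
    fix R :: real
    show "\<forall>\<^sub>F n in sequentially. \<forall>x\<in>{-R..R}. deriv (fs n) 0 + primitive (?q n) x = exp (S n x) * deriv (fs n) x"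
      using s_eq[of R] eventually_ge_at_top[of 1]
    proof eventually_elim
      case (elim n)
      have n: "\<And>x. deriv (fs n) differentiable (at x)" "continuous_on UNIV (ls n)"
        "\<And>x. L_n \<sigma> \<beta> \<Phi> n (fs n) x = ls n x"
        using fs[OF elim(2)] unfolding C_k_2_iff C_k_0_iff by auto
      have qc: "continuous_on UNIV (?q n)"
        by (intro continuous_intros S_continuous s_continuous n) auto
      let ?D = "\<lambda>x. exp (S n x) * deriv (fs n) x - deriv (fs n) 0 - primitive (?q n) x"
      show ?case
      proof
        fix x assume x: "x \<in> {-R..R}"
        \<comment> \<open>The exponential bound with C = 0 and a = 1 says that a zero derivative
          forces \<open>?D\<close> to vanish; it needs the derivative only within [-R, R].\<close>
        have "norm (?D x) \<le> 0 / 1 * exp (1 * \<bar>x\<bar>)"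
        proof (rule norm_le_exp_of_derivative_le[where D="?D" and D'="\<lambda>_. 0" and R=R])
          fix t :: real assume t: "\<bar>t\<bar> \<le> R"
          have "t \<in> {-R..R}"
            using t by auto
          with elim(1) have st: "s n t = sigma2_n \<sigma> \<Phi> n t"
            by blast
          have d2: "(deriv (fs n) has_real_derivative deriv (deriv (fs n)) t) (at t within {-R..R})"
            by (rule has_field_derivative_at_within) (simp add: n(1) DERIV_deriv_iff_real_differentiable)
          have ls: "ls n t = s n t / 2 * deriv (deriv (fs n)) t + b' n t * deriv (fs n) t"
            using n(3)[of t] by (simp add: L_n_def st b'_def)
          have "exp (S n t) * (2 * b' n t / s n t) * deriv (fs n) t + exp (S n t) * deriv (deriv (fs n)) t
              = ?q n t"
            unfolding ls by (simp add: field_simps)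
          moreover have "(?D has_real_derivative exp (S n t) * (2 * b' n t / s n t) * deriv (fs n) t
              + exp (S n t) * deriv (deriv (fs n)) t - 0 - ?q n t) (at t within {-R..R})"
            by (rule derivative_eq_intros d2 S_derivative primitive_has_real_derivative[OF qc] refl | simp)+
          ultimately show "(?D has_vector_derivative 0) (at t within {-R..R})"
            unfolding has_real_derivative_iff_has_vector_derivative[symmetric] by simp
        qed (use x in auto)
        then show "deriv (fs n) 0 + primitive (?q n) x = exp (S n x) * deriv (fs n) x"
          by simp
      qed
    qed
  qed
  moreover have "cconv (\<lambda>n x. exp (S n x) * deriv (fs n) x) (\<lambda>x. exp (\<Sigma> x) * deriv f x)"
    by (intro cconv_mult cconv_exp S_cconv f')
  ultimately have "(\<lambda>x. deriv f 0 + primitive (\<lambda>y. 2 * exp (\<Sigma> y) * l y / (\<sigma> y)\<^sup>2) x)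
      = (\<lambda>x. exp (\<Sigma> x) * deriv f x)"
    by (rule cconv_unique)
  from fun_cong[OF this, of x] show ?thesis
    by simp
qed

text \<open>The limit identity is read backwards: with the same constant \<open>a\<close> and the
  same \<open>l\<close>, replacing \<Sigma> by \<open>S n\<close> and \<sigma>^2 by
  \<open>s n\<close> defines the derivatives of the approximants.\<close>

lemma approximants_exist:
  assumes l: "continuous_on UNIV l" and w: "continuous_on UNIV w"
    and u: "\<And>x. (u has_real_derivative w x) (at x)"
    and eq: "\<And>x. exp (\<Sigma> x) * w x = a + primitive (\<lambda>y. 2 * exp (\<Sigma> y) * l y / (\<sigma> y)\<^sup>2) x"
  shows "\<exists>fs ls. (\<forall>n. C_k 2 (fs n) \<and> C_k 0 (ls n) \<and> (\<forall>x. L_n \<sigma> \<beta> \<Phi> n (fs n) x = ls n x)) \<and>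
    C_k_tendsto 1 fs u \<and> C_k_tendsto 0 ls l"
proof -
  let ?q = "\<lambda>n y. 2 * exp (S n y) * l y / s n y"
  define ws where "ws n x = exp (- S n x) * (a + primitive (?q n) x)" for n x
  \<comment> \<open>The regularized equation s_n/2 w' + b_n' w = l solved for w'.\<close>
  define w' where "w' n x = 2 / s n x * (l x - b' n x * ws n x)" for n x
  define fs where "fs n x = u 0 + primitive (ws n) x" for n x
  \<comment> \<open>Taken as the image under \<open>L_n\<close>, so that the required equation is
    exact everywhere, even where \<open>s n\<close> differs from \<open>sigma2_n\<close>. Where they
    agree, \<open>ls n\<close> is \<open>l\<close>.\<close>
  define ls where "ls n x = L_n \<sigma> \<beta> \<Phi> n (fs n) x" for n x
  have qc: "continuous_on UNIV (?q n)" for n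
    by (intro continuous_intros S_continuous s_continuous l) auto
  have ws': "(ws n has_real_derivative w' n x) (at x)" for n x
  proof -
    have "(ws n has_real_derivative - (exp (- S n x) * (2 * b' n x / s n x)) * (a + primitive (?q n) x)
        + exp (- S n x) * ?q n x) (at x)"
      unfolding ws_def[abs_def]
      by (rule derivative_eq_intros S_derivative primitive_has_real_derivative[OF qc] refl | simp)+
    moreover have "- (exp (- S n x) * (2 * b' n x / s n x)) * (a + primitive (?q n) x)
        + exp (- S n x) * ?q n x = w' n x"
      by (simp add: w'_def ws_def exp_minus field_simps)
    ultimately show ?thesis
      by simp
  qed
  have wsc: "continuous_on UNIV (ws n)" for n
    using ws' DERIV_isCont continuous_at_imp_continuous_on by blast
  have w'c: "continuous_on UNIV (w' n)" for n
    unfolding w'_def by (intro continuous_intros s_continuous l b'_continuous wsc) auto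
  have fs': "(fs n has_real_derivative ws n x) (at x)" for n x
    unfolding fs_def[abs_def]
    by (rule derivative_eq_intros primitive_has_real_derivative[OF wsc] refl | simp)+
  have dfs: "deriv (fs n) = ws n" "deriv (ws n) = w' n" for n
    using DERIV_imp_deriv[OF fs'] DERIV_imp_deriv[OF ws'] by (auto simp: fun_eq_iff)
  have fs2: "C_k 2 (fs n)" for n
    unfolding C_k_2_iff dfs using fs' ws' w'c real_differentiable_def by blast
  have ls_eq: "ls n x = sigma2_n \<sigma> \<Phi> n x / 2 * w' n x + b' n x * ws n x" for n x
    by (simp add: ls_def L_n_def dfs b'_def)
  have ls0: "C_k 0 (ls n)" for n
    unfolding C_k_0_iff ls_eq[abs_def]
    by (intro continuous_intros sigma2_n_continuous w'c b'_continuous wsc) simp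
  have "cconv ls l"
  proof (rule cconv_cong_eventually[OF cconv_fixed[OF l]])
    show "\<forall>\<^sub>F n in sequentially. \<forall>x\<in>{-R..R}. l x = ls n x" for R
      using s_eq[of R]
    proof eventually_elim
      case (elim n)
      show ?case
      proof
        fix x assume "x \<in> {-R..R}"
        with elim have "ls n x = s n x / 2 * w' n x + b' n x * ws n x"
          by (simp add: ls_eq)
        then show "l x = ls n x"
          by (simp add: w'_def field_simps)
      qed
    qed
  qed
  then have lim0: "C_k_tendsto 0 ls l"
    using C_k_tendsto_0_iff[OF l] by blast
  have "cconv (\<lambda>n. primitive (?q n)) (primitive (\<lambda>y. 2 * exp (\<Sigma> y) * l y / (\<sigma> y)\<^sup>2))"
    by (intro source_cconv l cconv_fixed always_eventually allI)
  then have "cconv ws (\<lambda>x. exp (- \<Sigma> x) * (a + primitive (\<lambda>y. 2 * exp (\<Sigma> y) * l y / (\<sigma> y)\<^sup>2) x))"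
    unfolding ws_def[abs_def]
    by (intro cconv_mult cconv_exp cconv_minus S_cconv cconv_add cconv_fixed continuous_on_const)
  moreover have "exp (- \<Sigma> x) * (a + primitive (\<lambda>y. 2 * exp (\<Sigma> y) * l y / (\<sigma> y)\<^sup>2) x) = w x" for x
    unfolding eq[symmetric] by (simp add: exp_minus)
  ultimately have wlim: "cconv ws w"
    by simp
  have "cconv (\<lambda>n. primitive (ws n)) (primitive w)"
    by (intro cconv_primitive w wlim always_eventually allI wsc)
  then have "cconv fs (\<lambda>x. u 0 + primitive w x)"
    unfolding fs_def[abs_def] by (intro cconv_add cconv_fixed continuous_on_const)
  moreover have "u x = u 0 + primitive w x" for x
    by (rule eq_primitive[OF w u])
  ultimately have ulim: "cconv fs u"
    by (metis (no_types, lifting) ext)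
  have "deriv u = w"
    using DERIV_imp_deriv[OF u] by (auto simp: fun_eq_iff)
  moreover have "continuous_on UNIV u"
    using u DERIV_isCont continuous_at_imp_continuous_on by blast
  ultimately have "C_k_tendsto 1 fs u"
    using ulim wlim w by (subst C_k_tendsto_1_iff) (simp_all add: dfs)
  then show ?thesis
    using fs2 ls0 lim0 by (intro exI[of _ fs] exI[of _ ls]) (auto simp: ls_def)
qed

end

text \<open>Left to right, the limit is taken along one mollifier. Right to left, approximants are
  built for every mollifier, which is possible because the integral identity does not mention
  \<Phi>.\<close>

theorem C1_solution_iff:
  assumes l: "continuous_on UNIV l"
  shows "C1_solution \<sigma> \<beta> l f \<longleftrightarrow> C_k 1 f \<and>
    (\<forall>x. exp (\<Sigma> x) * deriv f x = deriv f 0 + primitive (\<lambda>y. 2 * exp (\<Sigma> y) * l y / (\<sigma> y)\<^sup>2) x)"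
    (is "_ \<longleftrightarrow> _ \<and> ?eq")
proof (intro iffI conjI)
  assume sol: "C1_solution \<sigma> \<beta> l f"
  then show f1: "C_k 1 f"
    by (simp add: C1_solution_def)
  obtain \<Phi> where \<Phi>: "mollifier \<Phi>"
    using mollifier_exists by blast
  obtain fs ls where fs: "\<forall>n\<ge>1. C_k 2 (fs n) \<and> C_k 0 (ls n) \<and> (\<forall>x. L_n \<sigma> \<beta> \<Phi> n (fs n) x = ls n x)"
    "C_k_tendsto 1 fs f" "C_k_tendsto 0 ls l"
    using sol \<Phi> unfolding C1_solution_def by blast
  then show ?eq
    using solution_formula[OF \<Phi> f1 l, of fs ls] by blast
next
  assume *: "C_k 1 f \<and> ?eq"
  then have d: "(f has_real_derivative deriv f x) (at x)" for x
    unfolding C_k_1_iff by (simp add: DERIV_deriv_iff_real_differentiable)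
  have c: "continuous_on UNIV (deriv f)"
    using * unfolding C_k_1_iff by blast
  have "\<exists>fs ls. (\<forall>n. C_k 2 (fs n) \<and> C_k 0 (ls n) \<and> (\<forall>x. L_n \<sigma> \<beta> \<Phi> n (fs n) x = ls n x)) \<and>
    C_k_tendsto 1 fs f \<and> C_k_tendsto 0 ls l" if "mollifier \<Phi>" for \<Phi>
    using approximants_exist[OF that l c d] * by blast
  then show "C1_solution \<sigma> \<beta> l f"
    unfolding C1_solution_def using * by meson
qed

section \<open>The semilinear equation as a first order system\<close>

lemma semilinear_exists_unique:
  fixes F :: "real \<times> real \<times> real \<Rightarrow> real"
  assumes F: "continuous_on UNIV F"
    and lip: "\<And>a b. \<exists>C. \<forall>x\<in>{a..b}. C-lipschitz_on UNIV (\<lambda>(y, z). F (x, y, z))"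
  shows "\<exists>!u. C1_solution_semilinear \<sigma> \<beta> F u \<and> u 0 = x0 \<and> deriv u 0 = x1"
proof -
  define k where "k t = 2 * exp (\<Sigma> t) / (\<sigma> t)\<^sup>2" for t
  \<comment> \<open>The state is (u, v) with v = exp \<Sigma> u'; hence u' = exp(-\<Sigma>) v, and
    v' is the integrand of the integral identity.\<close>
  define G where "G t X = (exp (- \<Sigma> t) * snd X, k t * F (t, fst X, exp (- \<Sigma> t) * snd X))" for t X
  have kc: "continuous_on UNIV k"
    unfolding k_def by (intro continuous_intros \<Sigma> \<sigma>) simp
  have Ec: "continuous_on UNIV (\<lambda>t. exp (- \<Sigma> t))"
    by (intro continuous_intros \<Sigma>)
  have F_comp: "continuous_on UNIV (\<lambda>t. F (t, y t, z t))"
    if "continuous_on UNIV y" "continuous_on UNIV z" for y z :: "real \<Rightarrow> real"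
    by (rule continuous_on_compose2[OF F]) (auto intro!: continuous_intros that)
  interpret lipschitz_ode G
  proof
    show "continuous_on UNIV (\<lambda>t. G t (X t))" if "continuous_on UNIV X" for X
      unfolding G_def by (intro continuous_on_Pair continuous_on_mult F_comp continuous_on_snd
          continuous_on_fst that Ec kc)
    fix R :: real
    have bdd: "\<exists>M\<ge>0. \<forall>t\<in>{-R..R}. \<bar>h t\<bar> \<le> M" if "continuous_on UNIV h" for h :: "real \<Rightarrow> real"
    proof -
      have "bounded (h ` {-R..R})"
        by (intro compact_imp_bounded compact_continuous_image continuous_on_subset[OF that]) auto
      then show ?thesis
        unfolding bounded_pos by (auto intro: less_imp_le)
    qed
    obtain E where E: "E \<ge> 0" "\<And>t. t \<in> {-R..R} \<Longrightarrow> \<bar>exp (- \<Sigma> t)\<bar> \<le> E"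
      using bdd[OF Ec] by blast
    obtain K where K: "K \<ge> 0" "\<And>t. t \<in> {-R..R} \<Longrightarrow> \<bar>k t\<bar> \<le> K"
      using bdd[OF kc] by blast
    obtain C where C: "\<And>x. x \<in> {-R..R} \<Longrightarrow> C-lipschitz_on UNIV (\<lambda>(y, z). F (x, y, z))"
      using lip by blast
    \<comment> \<open>\<open>E\<close> comes from the first component. In the second,
      \<open>F\<close> contributes C times the change 1 + E of its two arguments, and the prefactor
      contributes \<open>K\<close>.\<close>
    have "norm (G t X - G t Y) \<le> (E + K * (C * (1 + E))) * norm (X - Y)" if "\<bar>t\<bar> \<le> R" for t X Y
    proof -
      have t: "t \<in> {-R..R}"
        using that by auto
      have C0: "C \<ge> 0"
        using C[OF t] by (rule lipschitz_on_nonneg)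
      have f: "norm (fst X - fst Y) \<le> norm (X - Y)"
        using norm_fst_le[of "fst X - fst Y" "snd X - snd Y"] by (simp add: minus_prod_def)
      have s: "norm (snd X - snd Y) \<le> norm (X - Y)"
        using norm_snd_le[of "snd X - snd Y" "fst X - fst Y"] by (simp add: minus_prod_def)
      have e: "norm (exp (- \<Sigma> t) * snd X - exp (- \<Sigma> t) * snd Y) \<le> E * norm (X - Y)"
        unfolding right_diff_distrib[symmetric] norm_mult
        using E(2)[OF t] s E(1) by (intro mult_mono) auto
      have "norm (F (t, fst X, exp (- \<Sigma> t) * snd X) - F (t, fst Y, exp (- \<Sigma> t) * snd Y))
          \<le> C * norm ((fst X, exp (- \<Sigma> t) * snd X) - (fst Y, exp (- \<Sigma> t) * snd Y))"
        using lipschitz_onD[OF C[OF t] UNIV_I UNIV_I, of "(fst X, exp (- \<Sigma> t) * snd X)"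
            "(fst Y, exp (- \<Sigma> t) * snd Y)"] by (simp add: dist_norm)
      also have "\<dots> \<le> C * (norm (fst X - fst Y) + norm (exp (- \<Sigma> t) * snd X - exp (- \<Sigma> t) * snd Y))"
        unfolding diff_Pair using C0 by (intro mult_left_mono norm_Pair_le)
      also have "\<dots> \<le> C * (norm (X - Y) + E * norm (X - Y))"
        using C0 by (intro mult_left_mono add_mono f e)
      finally have F': "norm (F (t, fst X, exp (- \<Sigma> t) * snd X) - F (t, fst Y, exp (- \<Sigma> t) * snd Y))
          \<le> C * (1 + E) * norm (X - Y)"
        by (simp add: algebra_simps)
      have kF: "norm (k t * F (t, fst X, exp (- \<Sigma> t) * snd X) - k t * F (t, fst Y, exp (- \<Sigma> t) * snd Y))
          \<le> K * (C * (1 + E) * norm (X - Y))"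
        unfolding right_diff_distrib[symmetric] norm_mult
        using K(2)[OF t] F' K(1) by (intro mult_mono) auto
      have "norm (G t X - G t Y) \<le> E * norm (X - Y) + K * (C * (1 + E) * norm (X - Y))"
        unfolding G_def diff_Pair by (rule order_trans[OF norm_Pair_le add_mono[OF e kF]])
      then show ?thesis
        by (simp add: algebra_simps)
    qed
    then show "\<exists>L. \<forall>t X Y. \<bar>t\<bar> \<le> R \<longrightarrow> norm (G t X - G t Y) \<le> L * norm (X - Y)"
      by blast
  qed
  \<comment> \<open>The integral identity exhibits exp \<Sigma> u' as a primitive of a continuous
    function, which is how its derivative is obtained without differentiating u'.\<close>
  have sol_ode: "((\<lambda>t. (u t, exp (\<Sigma> t) * deriv u t)) has_vector_derivative
      G t (u t, exp (\<Sigma> t) * deriv u t)) (at t)"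
    if "C1_solution_semilinear \<sigma> \<beta> F u" for u t
  proof -
    have u1: "C_k 1 u" and sol: "C1_solution \<sigma> \<beta> (\<lambda>x. F (x, u x, deriv u x)) u"
      using that by (auto simp: C1_solution_semilinear_def)
    have u: "(u has_real_derivative deriv u x) (at x)" for x
      using u1 unfolding C_k_1_iff by (simp add: DERIV_deriv_iff_real_differentiable)
    have "continuous_on UNIV u"
      using u DERIV_isCont continuous_at_imp_continuous_on by blast
    moreover have "continuous_on UNIV (deriv u)"
      using u1 unfolding C_k_1_iff by blast
    ultimately have l: "continuous_on UNIV (\<lambda>x. F (x, u x, deriv u x))"
      by (rule F_comp)
    have q: "continuous_on UNIV (\<lambda>y. 2 * exp (\<Sigma> y) * F (y, u y, deriv u y) / (\<sigma> y)\<^sup>2)"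
      by (intro continuous_intros \<Sigma> \<sigma> l) simp
    have "exp (\<Sigma> x) * deriv u x
        = deriv u 0 + primitive (\<lambda>y. 2 * exp (\<Sigma> y) * F (y, u y, deriv u y) / (\<sigma> y)\<^sup>2) x" for x
      using sol C1_solution_iff[OF l] by blast
    moreover have "((\<lambda>x. deriv u 0 + primitive (\<lambda>y. 2 * exp (\<Sigma> y) * F (y, u y, deriv u y) / (\<sigma> y)\<^sup>2) x)
        has_real_derivative 2 * exp (\<Sigma> t) * F (t, u t, deriv u t) / (\<sigma> t)\<^sup>2) (at t)"
      by (rule derivative_eq_intros primitive_has_real_derivative[OF q] refl | simp)+
    ultimately have "((\<lambda>x. exp (\<Sigma> x) * deriv u x)
        has_real_derivative 2 * exp (\<Sigma> t) * F (t, u t, deriv u t) / (\<sigma> t)\<^sup>2) (at t)"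
      by (simp only:)
    from has_vector_derivative_Pair[OF u[of t, unfolded has_real_derivative_iff_has_vector_derivative]
        this[unfolded has_real_derivative_iff_has_vector_derivative]]
    show ?thesis
      by (simp add: G_def k_def exp_minus mult.assoc[symmetric])
  qed
  show ?thesis
  proof (rule ex_ex1I)
    \<comment> \<open>Since \<Sigma> vanishes at 0, the second component starts at exp(\<Sigma>(0))
      x1 = x1.\<close>
    obtain X where X0: "X 0 = (x0, x1)" and X: "\<And>t. (X has_vector_derivative G t (X t)) (at t)"
      using exists_solution[of "(x0, x1)"] by blast
    define u where "u t = fst (X t)" for t
    define v where "v t = snd (X t)" for t
    define w where "w t = exp (- \<Sigma> t) * v t" for t
    define l where "l t = F (t, u t, w t)" for t
    have u': "(u has_real_derivative w t) (at t)" for t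
      using bounded_linear.has_vector_derivative[OF bounded_linear_fst X[of t]]
      by (simp add: u_def[abs_def] v_def w_def G_def has_real_derivative_iff_has_vector_derivative)
    have v': "(v has_real_derivative k t * l t) (at t)" for t
      using bounded_linear.has_vector_derivative[OF bounded_linear_snd X[of t]]
      by (simp add: u_def v_def[abs_def] w_def l_def G_def has_real_derivative_iff_has_vector_derivative)
    have du: "deriv u = w"
      using DERIV_imp_deriv[OF u'] by (rule ext)
    have "continuous_on UNIV v" "continuous_on UNIV u"
      using u' v' DERIV_isCont continuous_at_imp_continuous_on by blast+
    then have w: "continuous_on UNIV w" and l: "continuous_on UNIV l"
      unfolding l_def w_def by (auto intro!: F_comp continuous_on_mult Ec)
    have u1: "C_k 1 u"
      unfolding C_k_1_iff du using u' w real_differentiable_def by blast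
    have "exp (\<Sigma> x) * w x = deriv u 0 + primitive (\<lambda>y. 2 * exp (\<Sigma> y) * l y / (\<sigma> y)\<^sup>2) x" for x
    proof -
      have "v x = v 0 + primitive (\<lambda>y. k y * l y) x"
        by (rule eq_primitive[OF continuous_on_mult[OF kc l] v'])
      \<comment> \<open>\<open>\<Sigma>_0\<close> was derived relative to a mollifier, so an
        arbitrary one is supplied by choice.\<close>
      moreover have "exp (\<Sigma> x) * w x = v x" "deriv u 0 = v 0"
        using \<Sigma>_0[OF someI_ex[OF mollifier_exists]] by (simp_all add: w_def du exp_minus)
      ultimately show ?thesis
        by (simp add: k_def)
    qed
    then have "C1_solution \<sigma> \<beta> l u"
      using C1_solution_iff[OF l] u1 du by blast
    moreover have "l = (\<lambda>x. F (x, u x, deriv u x))"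
      by (simp add: l_def[abs_def] du)
    ultimately have "C1_solution_semilinear \<sigma> \<beta> F u"
      using u1 by (simp only: C1_solution_semilinear_def)
    moreover have "u 0 = x0" "deriv u 0 = x1"
      using X0 \<Sigma>_0[OF someI_ex[OF mollifier_exists]] by (simp_all add: u_def v_def w_def du)
    ultimately show "\<exists>u. C1_solution_semilinear \<sigma> \<beta> F u \<and> u 0 = x0 \<and> deriv u 0 = x1"
      by blast
  next
    fix u1 u2
    assume 1: "C1_solution_semilinear \<sigma> \<beta> F u1 \<and> u1 0 = x0 \<and> deriv u1 0 = x1"
      and 2: "C1_solution_semilinear \<sigma> \<beta> F u2 \<and> u2 0 = x0 \<and> deriv u2 0 = x1"
    have "(\<lambda>t. (u1 t, exp (\<Sigma> t) * deriv u1 t)) = (\<lambda>t. (u2 t, exp (\<Sigma> t) * deriv u2 t))"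
    proof (rule unique)
      show "((\<lambda>t. (u1 t, exp (\<Sigma> t) * deriv u1 t)) has_vector_derivative
          G t (u1 t, exp (\<Sigma> t) * deriv u1 t)) (at t)" for t
        using 1 by (intro sol_ode) simp
      show "((\<lambda>t. (u2 t, exp (\<Sigma> t) * deriv u2 t)) has_vector_derivative
          G t (u2 t, exp (\<Sigma> t) * deriv u2 t)) (at t)" for t
        using 2 by (intro sol_ode) simp
    qed (use 1 2 in simp)
    then show "u1 = u2"
      by (simp add: fun_eq_iff)
  qed
qed

end

theorem proposition3p6:
  fixes \<sigma> \<beta> :: "real \<Rightarrow> real"
    and F :: "real \<times> real \<times> real \<Rightarrow> real"
  assumes "continuous_on UNIV \<sigma>" and "continuous_on UNIV \<beta>"
    and "\<And>x. \<sigma> x > 0"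
    and "\<And>\<Phi> n. mollifier \<Phi> \<Longrightarrow> n \<ge> 1 \<Longrightarrow> convolvable (\<lambda>x. (\<sigma> x)\<^sup>2) (rescale \<Phi> n)"
    and "\<And>\<Phi> n. mollifier \<Phi> \<Longrightarrow> n \<ge> 1 \<Longrightarrow> convolvable \<beta> (rescale \<Phi> n)"
    and "\<exists>\<Sigma>. C_k 0 \<Sigma> \<and> (\<forall>\<Phi>. mollifier \<Phi> \<longrightarrow> C_k_tendsto 0 (Sigma_n \<sigma> \<beta> \<Phi>) \<Sigma>)"
    and "continuous_on UNIV F"
    and "\<And>a b. \<exists>C. \<forall>x\<in>{a..b}. C-lipschitz_on UNIV (\<lambda>(y, z). F (x, y, z))"
  shows "\<forall>x0 x1. \<exists>!u. C1_solution_semilinear \<sigma> \<beta> F u \<and> u 0 = x0 \<and> deriv u 0 = x1"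
proof -
  obtain \<Sigma> where "C_k 0 \<Sigma>" "\<And>\<Phi>. mollifier \<Phi> \<Longrightarrow> C_k_tendsto 0 (Sigma_n \<sigma> \<beta> \<Phi>) \<Sigma>"
    using assms(6) by blast
  with assms(1-5) interpret mollified_operator \<sigma> \<beta> \<Sigma>
    by unfold_locales (auto simp: C_k_0_iff)
  show ?thesis
    using semilinear_exists_unique[OF assms(7,8)] by blast
qed

end
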